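(* Fix $c>0$ and $k\in(0,\sqrt{c}/2)$. The solitary wave momentum density $\mu=\mu(\cdot;k)$ is a critical point of the action functional $$\Lambda(m)=\omega_0\,\mathcal{E}(m)+\omega_1F_1(m)+F_2(m),\qquad m\in X_k,$$ provided we take $$\omega_0=-9a^{-2/3}\quad\text{and}\quad \omega_1=9c\,a^{-4/3}(2E+c),$$ where $a=k(c-k^2)^{3/2}$ and $E=\frac{k^2(c-2k^2)}{2c}$.
   Context: Setting: the Novikov equation is $u_t-u_{xxt}=u^2u_{xxx}-4u^2u_x+3uu_xu_{xx}$. For fixed $c>0$ and $k\in(0,\sqrt c/2)$, set $a=k(c-k^2)^{3/2}$ and $E=\frac{k^2(c-2k^2)}{2c}$; $\phi=\phi(\cdot;k)$ denotes the unique nonconstant smooth even function on $\mathbb{R}$ with $\phi'(0)=0$, $\phi(x)\to k$ as $x\to\pm\infty$, $\phi^2<c$, and $\phi-\phi''=a(c-\phi^2)^{-3/2}$ (so that $u(x,t)=\phi(x-ct)$ is a smooth solitary wave of the Novikov equation). It also satisfies $\frac12(\phi')^2=E+\frac12\phi^2-\frac{a\phi}{c\sqrt{c-\phi^2}}$. Its momentum density is $\mu=\mu(\cdot;k)=\phi-\phi''>0$. $X_k$ is the set of functions $m$ on $\mathbb{R}$ with $m-k\in H^1(\mathbb{R})$ and $m(x)>0$ for all $x$. The operator $(1-\partial_x^2)^{-1}$ is convolution with $\frac12e^{-|x|}$ (so $(1-\partial_x^2)^{-1}\mu=\phi$). For $m\in X_k$, $$\mathcal{E}(m)=\int_{\mathbb{R}}\left(m(1-\partial_x^2)^{-1}m-k^2\right)dx,\quad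 F_1(m)=\int_{\mathbb{R}}\left(m^{2/3}-k^{2/3}\right)dx,$$ $$F_2(m)=\int_{\mathbb{R}}\left(m^{-8/3}m_x^2+9\left(m^{-2/3}-k^{-2/3}\right)\right)dx.$$ Only the variation of the combination $\Lambda$ (not those of $\mathcal{E},F_1,F_2$ separately) is meaningful on $X_k$ because of the nonzero end state. That $\mu$ is a critical point of $\Lambda$ means $\frac{\delta\Lambda}{\delta m}(\mu)=0$, i.e. the Euler–Lagrange equation $$2\omega_0(1-\partial_x^2)^{-1}\mu+\frac{2\omega_1}{3\mu^{1/3}}-2\mu^{-8/3}\mu''-6\mu^{-5/3}+\frac{8(\mu')^2}{3\mu^{11/3}}=0\quad\text{on }\mathbb{R}.$$ *)

theory Defs
  imports "HOL-Analysis.Analysis"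
begin

definition smooth :: "(real \<Rightarrow> real) \<Rightarrow> bool" where
  "smooth f \<longleftrightarrow> (\<forall>n. (deriv ^^ n) f differentiable_on UNIV)"

definition test_function :: "(real \<Rightarrow> real) \<Rightarrow> bool" where
  "test_function h \<longleftrightarrow> smooth h \<and> compact (closure {x. h x \<noteq> 0})"

(* The Sobolev space H^1(R), each class being represented by its locally absolutely continuous
   member.  Such a function is differentiable almost everywhere and its a.e. derivative is its weak
   derivative; the value of deriv on the exceptional null set is irrelevant. *)
definition sobolev_H1 :: "(real \<Rightarrow> real) set" where
  "sobolev_H1 = {f.
     (\<forall>a b. a \<le> b \<longrightarrow> set_integrable lborel {a..b} (deriv f) \<and>
                       f b - f a = (LINT x:{a..b}|lborel. deriv f x)) \<and>
     integrable lborel (\<lambda>x. (f x)\<^sup>2) \<and>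
     integrable lborel (\<lambda>x. (deriv f x)\<^sup>2)}"

definition X_space :: "real \<Rightarrow> (real \<Rightarrow> real) set" where
  "X_space k = {m. (\<lambda>x. m x - k) \<in> sobolev_H1 \<and> (\<forall>x. m x > 0)}"

(* (1 - d^2/dx^2)^{-1} *)
definition helmholtz_inv :: "(real \<Rightarrow> real) \<Rightarrow> real \<Rightarrow> real" where
  "helmholtz_inv f x = (LINT y|lborel. exp (- \<bar>x - y\<bar>) / 2 * f y)"

definition energy_density :: "real \<Rightarrow> (real \<Rightarrow> real) \<Rightarrow> real \<Rightarrow> real" where
  "energy_density k m x = m x * helmholtz_inv m x - k\<^sup>2"

definition F1_density :: "real \<Rightarrow> (real \<Rightarrow> real) \<Rightarrow> real \<Rightarrow> real" where
  "F1_density k m x = m x powr (2/3) - k powr (2/3)"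

definition F2_density :: "real \<Rightarrow> (real \<Rightarrow> real) \<Rightarrow> real \<Rightarrow> real" where
  "F2_density k m x =
     m x powr (-8/3) * (deriv m x)\<^sup>2 + 9 * (m x powr (-2/3) - k powr (-2/3))"

definition energy :: "real \<Rightarrow> (real \<Rightarrow> real) \<Rightarrow> real" where
  "energy k m = (LINT x|lborel. energy_density k m x)"

definition F1 :: "real \<Rightarrow> (real \<Rightarrow> real) \<Rightarrow> real" where
  "F1 k m = (LINT x|lborel. F1_density k m x)"

definition F2 :: "real \<Rightarrow> (real \<Rightarrow> real) \<Rightarrow> real" where
  "F2 k m = (LINT x|lborel. F2_density k m x)"

definition action :: "real \<Rightarrow> real \<Rightarrow> real \<Rightarrow> (real \<Rightarrow> real) \<Rightarrow> real" where
  "action k \<omega>0 \<omega>1 m = \<omega>0 * energy k m + \<omega>1 * F1 k m + F2 k m"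

(* Because of the end state k > 0 the three integrals need not converge on all of X_k (m - k need
   not be in L^1), and a divergent Lebesgue integral has the default value 0.  This is the part of
   X_k on which the action is a genuine number. *)
definition action_domain :: "real \<Rightarrow> (real \<Rightarrow> real) set" where
  "action_domain k = {m \<in> X_space k.
     integrable lborel (energy_density k m) \<and>
     integrable lborel (F1_density k m) \<and>
     integrable lborel (F2_density k m)}"

(* g is the variational derivative (delta L / delta m)(m) of a functional L defined on D. *)
definition has_variational_derivative ::
  "(real \<Rightarrow> real) set \<Rightarrow> ((real \<Rightarrow> real) \<Rightarrow> real) \<Rightarrow> (real \<Rightarrow> real) \<Rightarrow> (real \<Rightarrow> real) \<Rightarrow> bool" where
  "has_variational_derivative D L m g \<longleftrightarrow>
     (\<forall>h. test_function h \<longrightarrow>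
        (\<forall>\<^sub>F \<epsilon> in nhds 0. (\<lambda>x. m x + \<epsilon> * h x) \<in> D) \<and>
        integrable lborel (\<lambda>x. g x * h x) \<and>
        ((\<lambda>\<epsilon>. L (\<lambda>x. m x + \<epsilon> * h x)) has_real_derivative (LINT x|lborel. g x * h x)) (at 0))"

definition critical_point ::
  "(real \<Rightarrow> real) set \<Rightarrow> ((real \<Rightarrow> real) \<Rightarrow> real) \<Rightarrow> (real \<Rightarrow> real) \<Rightarrow> bool" where
  "critical_point D L m \<longleftrightarrow> m \<in> D \<and> has_variational_derivative D L m (\<lambda>x. 0)"

definition wave_a :: "real \<Rightarrow> real \<Rightarrow> real" where
  "wave_a c k = k * (c - k\<^sup>2) powr (3/2)"

definition wave_E :: "real \<Rightarrow> real \<Rightarrow> real" where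
  "wave_E c k = k\<^sup>2 * (c - 2 * k\<^sup>2) / (2 * c)"

definition solitary_wave :: "real \<Rightarrow> real \<Rightarrow> (real \<Rightarrow> real) \<Rightarrow> bool" where
  "solitary_wave c k \<phi> \<longleftrightarrow>
     smooth \<phi> \<and>
     \<not> \<phi> constant_on UNIV \<and>
     (\<forall>x. \<phi> (- x) = \<phi> x) \<and>
     deriv \<phi> 0 = 0 \<and>
     (\<phi> \<longlongrightarrow> k) at_top \<and> (\<phi> \<longlongrightarrow> k) at_bot \<and>
     (\<forall>x. (\<phi> x)\<^sup>2 < c) \<and>
     (\<forall>x. \<phi> x - deriv (deriv \<phi>) x = wave_a c k * (c - (\<phi> x)\<^sup>2) powr (-3/2))"

definition momentum :: "(real \<Rightarrow> real) \<Rightarrow> real \<Rightarrow> real" where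
  "momentum \<phi> x = \<phi> x - deriv (deriv \<phi>) x"

(* The Euler-Lagrange expression delta Lambda / delta m. *)
definition action_gradient :: "real \<Rightarrow> real \<Rightarrow> (real \<Rightarrow> real) \<Rightarrow> real \<Rightarrow> real" where
  "action_gradient \<omega>0 \<omega>1 m x =
     2 * \<omega>0 * helmholtz_inv m x
     + 2 * \<omega>1 / (3 * m x powr (1/3))
     - 2 * m x powr (-8/3) * deriv (deriv m) x
     - 6 * m x powr (-5/3)
     + 8 * (deriv m x)\<^sup>2 / (3 * m x powr (11/3))"

end

theory Submission
  imports Defs
begin

text \<open>
  Put \<open>s = c - \<phi>\<^sup>2\<close>, so that \<open>\<mu> = a s powr (-3/2)\<close> and \<open>helmholtz_inv \<mu> = \<phi>\<close>. Every term of the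
  Euler-Lagrange expression is then an algebraic function of \<open>\<phi>\<close>, \<open>\<phi>'\<close> and \<open>\<phi>''\<close>; eliminating
  \<open>\<phi>''\<close> by the profile equation and \<open>\<phi>'\<^sup>2\<close> by its energy integral makes it vanish identically.

  For the variational statement, \<open>\<phi> - k\<close> decays exponentially since \<open>k\<close> is a saddle of the profile
  equation (this is where \<open>4 k\<^sup>2 < c\<close> enters), so all densities are integrable at \<open>\<mu>\<close>. A test
  function \<open>h\<close> changes the densities of \<open>F1\<close> and \<open>F2\<close> only on a compact interval, where one may
  differentiate under the integral; the energy is quadratic and the symmetry of \<open>helmholtz_inv\<close>
  (Fubini) yields its derivative. The resulting first variation is the Euler-Lagrange expression
  times \<open>h\<close> plus the exact derivative of \<open>2 \<mu> powr (-8/3) \<mu>' h\<close>, which has compact support.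
\<close>

subsection \<open>Integrals over the real line\<close>

lemma integrable_bounded_mult:
  fixes f g :: "real \<Rightarrow> real"
  assumes "integrable lborel f" "g \<in> borel_measurable borel" "\<And>x. \<bar>g x\<bar> \<le> B"
  shows "integrable lborel (\<lambda>x. g x * f x)"
proof (rule Bochner_Integration.integrable_bound)
  show "integrable lborel (\<lambda>x. B * f x)"
    using assms(1) by simp
  show "(\<lambda>x. g x * f x) \<in> borel_measurable lborel"
    using assms(1,2) by (simp add: borel_measurable_integrable)
  have "\<bar>g x\<bar> * \<bar>f x\<bar> \<le> \<bar>B\<bar> * \<bar>f x\<bar>" for x
    using assms(3)[of x] by (intro mult_right_mono) auto
  then show "AE x in lborel. norm (g x * f x) \<le> norm (B * f x)"
    by (simp add: abs_mult)
qed

lemma integrable_power2_add: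
  fixes f g :: "real \<Rightarrow> real"
  assumes [measurable]: "f \<in> borel_measurable borel" "g \<in> borel_measurable borel"
    and "integrable lborel (\<lambda>x. (f x)\<^sup>2)" "integrable lborel (\<lambda>x. (g x)\<^sup>2)"
  shows "integrable lborel (\<lambda>x. (f x + g x)\<^sup>2)"
proof (rule Bochner_Integration.integrable_bound)
  show "integrable lborel (\<lambda>x. 2 * (f x)\<^sup>2 + 2 * (g x)\<^sup>2)"
    using assms(3,4) by simp
  have "(f x + g x)\<^sup>2 \<le> 2 * (f x)\<^sup>2 + 2 * (g x)\<^sup>2" for x
    using zero_le_power2[of "f x - g x"] by (simp add: power2_sum power2_diff)
  then show "AE x in lborel. norm ((f x + g x)\<^sup>2) \<le> norm (2 * (f x)\<^sup>2 + 2 * (g x)\<^sup>2)"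
    by simp
qed simp

lemma integrable_compact_support:
  fixes f :: "real \<Rightarrow> real"
  assumes "continuous_on UNIV f" "\<And>x. R < \<bar>x\<bar> \<Longrightarrow> f x = 0"
  shows "integrable lborel f" "(LINT x|lborel. f x) = integral {-R..R} f"
proof -
  have eq: "f = (\<lambda>x. indicator {-R..R} x *\<^sub>R f x)"
    using assms(2) by (force simp: indicator_def)
  have si: "set_integrable lborel {-R..R} f"
    by (intro borel_integrable_atLeastAtMost' continuous_on_subset[OF assms(1)]) auto
  then show "integrable lborel f"
    unfolding set_integrable_def by (subst eq)
  show "(LINT x|lborel. f x) = integral {-R..R} f"
    using set_borel_integral_eq_integral(2)[OF si] unfolding set_lebesgue_integral_def
    by (subst eq)
qed

lemma compact_support_bounded:
  fixes f :: "real \<Rightarrow> real"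
  assumes "continuous_on UNIV f" "\<And>x. R < \<bar>x\<bar> \<Longrightarrow> f x = 0"
  obtains B where "0 < B" "\<And>x. \<bar>f x\<bar> \<le> B"
proof -
  have "bounded (f ` {-R..R})"
    by (intro compact_imp_bounded compact_continuous_image continuous_on_subset[OF assms(1)]) auto
  then obtain B where B: "\<forall>y \<in> f ` {-R..R}. norm y \<le> B"
    unfolding bounded_iff by blast
  have "\<bar>f x\<bar> \<le> \<bar>B\<bar> + 1" for x
  proof (cases "R < \<bar>x\<bar>")
    case False
    then have "f x \<in> f ` {-R..R}" by (intro imageI) auto
    then show ?thesis using B by force
  qed (simp add: assms(2))
  then show thesis
    by (intro that[of "\<bar>B\<bar> + 1"]) auto
qed

text \<open>By the mean value theorem: \<open>G'\<close> is bounded on the compact interval, so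
  \<open>G (f x) - G k\<close> is dominated by a multiple of \<open>f x - k\<close>. This carries
  integrability from \<open>\<phi> x - k\<close> over to \<open>\<mu> x - k\<close>, to the powers
  of \<open>\<mu>\<close> and to the square of \<open>\<phi>1\<close>.\<close>

lemma integrable_comp_minus_const:
  fixes G :: "real \<Rightarrow> real"
  assumes G: "\<And>t. t \<in> {\<alpha>..\<beta>} \<Longrightarrow> (G has_real_derivative G' t) (at t)"
    and G': "continuous_on {\<alpha>..\<beta>} G'"
    and f: "continuous_on UNIV f" "\<And>x. f x \<in> {\<alpha>..\<beta>}" "k \<in> {\<alpha>..\<beta>}"
    and int: "integrable lborel (\<lambda>x. f x - k)"
  shows "integrable lborel (\<lambda>x. G (f x) - G k)"
proof -
  have "bounded (G' ` {\<alpha>..\<beta>})"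
    by (intro compact_imp_bounded compact_continuous_image G' compact_Icc)
  then obtain B where B: "\<And>t. t \<in> {\<alpha>..\<beta>} \<Longrightarrow> norm (G' t) \<le> B"
    unfolding bounded_iff by blast
  have lip: "norm (G (f x) - G k) \<le> B * norm (f x - k)" for x
    by (rule field_differentiable_bound[of "{\<alpha>..\<beta>}" G G'])
       (use B f(2,3) G in \<open>auto intro: has_field_derivative_at_within\<close>)
  have "continuous_on {\<alpha>..\<beta>} G"
    by (intro continuous_at_imp_continuous_on ballI DERIV_isCont[OF G])
  then have "continuous_on UNIV (\<lambda>x. G (f x))"
    by (rule continuous_on_compose2[OF _ f(1)]) (use f(2) in auto)
  then have [measurable]: "(\<lambda>x. G (f x)) \<in> borel_measurable borel"
    by (rule borel_measurable_continuous_onI)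
  show ?thesis
  proof (rule Bochner_Integration.integrable_bound)
    show "integrable lborel (\<lambda>x. B * norm (f x - k))"
      using int by simp
    show "AE x in lborel. norm (G (f x) - G k) \<le> norm (B * norm (f x - k))"
      by (intro AE_I2 order_trans[OF lip]) simp
  qed simp
qed

text \<open>The variation of a density is supported in a fixed compact interval, so the Leibniz rule on
  that interval differentiates the integral over the whole line.\<close>

lemma LINT_compact_variation:
  fixes L L' :: "real \<Rightarrow> real \<Rightarrow> real"
  assumes "0 < r"
    and deriv: "\<And>e x. \<bar>e\<bar> < r \<Longrightarrow> ((\<lambda>e. L e x) has_real_derivative L' e x) (at e)"
    and cont': "continuous_on ({-r<..<r} \<times> {-R..R}) (\<lambda>(e, x). L' e x)"
    and cont: "\<And>e. \<bar>e\<bar> < r \<Longrightarrow> continuous_on {-R..R} (L e)"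
    and outside: "\<And>e x. R < \<bar>x\<bar> \<Longrightarrow> L e x = L 0 x"
    and int: "integrable lborel (L 0)"
  shows "\<And>e. \<bar>e\<bar> < r \<Longrightarrow> integrable lborel (L e)"
    and "((\<lambda>e. LINT x|lborel. L e x) has_real_derivative integral {-R..R} (L' 0)) (at 0)"
proof -
  have eq: "L e = (\<lambda>x. L 0 x + indicator {-R..R} x *\<^sub>R (L e x - L 0 x))" for e
  proof
    fix x show "L e x = L 0 x + indicator {-R..R} x *\<^sub>R (L e x - L 0 x)"
      using outside[of x e] by (cases "R < \<bar>x\<bar>") (auto simp: indicator_def)
  qed
  have si: "set_integrable lborel {-R..R} (\<lambda>x. L e x - L 0 x)" if "\<bar>e\<bar> < r" for e
    by (intro borel_integrable_atLeastAtMost' continuous_intros cont that) (use \<open>0 < r\<close> in auto)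
  have intL: "integrable lborel (L e)" if "\<bar>e\<bar> < r" for e
    by (subst eq[of e]) (intro Bochner_Integration.integrable_add int si[OF that, unfolded set_integrable_def])
  then show "\<And>e. \<bar>e\<bar> < r \<Longrightarrow> integrable lborel (L e)" .
  have intI: "L e integrable_on {-R..R}" if "\<bar>e\<bar> < r" for e
    by (intro integrable_continuous_real cont that)
  \<comment> \<open>\<open>C\<close> is the contribution of the complement of
    \<open>{-R..R}\<close>, which does not depend on \<open>e\<close>.\<close>
  define C where "C = (LINT x|lborel. L 0 x) - integral {-R..R} (L 0)"
  have val: "(LINT x|lborel. L e x) = C + integral {-R..R} (L e)" if "\<bar>e\<bar> < r" for e
  proof -
    have "(LINT x|lborel. L e x) = (LINT x|lborel. L 0 x) + (LINT x:{-R..R}|lborel. L e x - L 0 x)"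
      unfolding set_lebesgue_integral_def
      by (subst eq[of e], intro Bochner_Integration.integral_add int si[OF that, unfolded set_integrable_def])
    also have "(LINT x:{-R..R}|lborel. L e x - L 0 x) = integral {-R..R} (\<lambda>x. L e x - L 0 x)"
      by (rule set_borel_integral_eq_integral(2)[OF si[OF that]])
    also have "\<dots> = integral {-R..R} (L e) - integral {-R..R} (L 0)"
      by (intro integral_diff intI that) (use \<open>0 < r\<close> in auto)
    finally show ?thesis by (simp add: C_def)
  qed
  have "((\<lambda>e. integral (cbox (-R) R) (L e)) has_real_derivative integral (cbox (-R) R) (L' 0))
      (at 0 within {-r<..<r})"
    by (rule leibniz_rule_field_derivative)
       (use \<open>0 < r\<close> intI cont' in \<open>auto intro!: has_field_derivative_at_within[OF deriv]\<close>)
  then have "((\<lambda>e. integral {-R..R} (L e)) has_real_derivative integral {-R..R} (L' 0)) (at 0)"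
    using \<open>0 < r\<close> by (simp add: at_within_open[of _ "{-r<..<r}"])
  then have "((\<lambda>e. C + integral {-R..R} (L e)) has_real_derivative integral {-R..R} (L' 0)) (at 0)"
    by (auto intro!: derivative_eq_intros)
  moreover have "\<forall>\<^sub>F e in nhds 0. (LINT x|lborel. L e x) = C + integral {-R..R} (L e)"
    using eventually_nhds_in_open[of "{-r<..<r}" 0] \<open>0 < r\<close>
    by (auto elim!: eventually_mono intro!: val)
  ultimately show "((\<lambda>e. LINT x|lborel. L e x) has_real_derivative integral {-R..R} (L' 0)) (at 0)"
    by (subst DERIV_cong_ev[OF refl _ refl])
qed

subsection \<open>The inverse of the Helmholtz operator\<close>

text \<open>An antiderivative of \<open>exp (x - y) * (f y - f'' y)\<close> in \<open>y\<close> is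
  \<open>- exp (x - y) * (f y + f' y)\<close>.\<close>

lemma has_bochner_integral_exp_half_line:
  fixes f f1 f2 :: "real \<Rightarrow> real"
  assumes f: "\<And>x. (f has_real_derivative f1 x) (at x)" "\<And>x. (f1 has_real_derivative f2 x) (at x)"
    and cont: "continuous_on UNIV f2"
    and bdd: "\<And>x. \<bar>f x\<bar> \<le> B" "\<And>x. \<bar>f1 x\<bar> \<le> B"
    and nonneg: "\<And>x. f2 x \<le> f x"
  shows "has_bochner_integral lborel
     (\<lambda>y. exp (x - y) * (f y - f2 y) * indicator {x..} y) (f x + f1 x)"
proof (rule has_bochner_integral_nn_integral)
  have cf: "continuous_on UNIV f"
    by (intro continuous_at_imp_continuous_on ballI DERIV_isCont[OF f(1)])
  have [measurable]: "f \<in> borel_measurable borel" "f2 \<in> borel_measurable borel"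
    by (intro borel_measurable_continuous_onI cf cont)+
  show "(\<lambda>y. exp (x - y) * (f y - f2 y) * indicator {x..} y) \<in> borel_measurable lborel"
    by measurable
  show "AE y in lborel. 0 \<le> exp (x - y) * (f y - f2 y) * indicator {x..} y"
    using nonneg by (auto intro!: AE_I2 mult_nonneg_nonneg)
  let ?F = "\<lambda>y. - exp (x - y) * (f y + f1 y)"
  have dF: "(?F has_real_derivative exp (x - y) * (f y - f2 y)) (at y)" for y
    by (auto intro!: derivative_eq_intros f simp: algebra_simps)
  have lim: "(?F \<longlongrightarrow> 0) at_top"
  proof (rule Lim_null_comparison)
    have "norm (?F y) \<le> exp x * (2 * B) * exp (- y)" for y
    proof -
      have "norm (?F y) = exp (x - y) * \<bar>f y + f1 y\<bar>"
        by (simp add: abs_mult)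
      also have "\<dots> \<le> exp (x - y) * (2 * B)"
        using bdd[of y] by (intro mult_left_mono) auto
      finally show ?thesis by (simp add: exp_diff exp_minus divide_inverse mult_ac)
    qed
    then show "\<forall>\<^sub>F y in at_top. norm (?F y) \<le> exp x * (2 * B) * exp (- y)"
      by simp
    have "((\<lambda>y. exp (- y)) \<longlongrightarrow> (0 :: real)) at_top"
      by (rule filterlim_compose[OF exp_at_bot filterlim_uminus_at_bot_at_top])
    from tendsto_mult_left[OF this, of "exp x * (2 * B)"]
    show "((\<lambda>y. exp x * (2 * B) * exp (- y)) \<longlongrightarrow> 0) at_top"
      by simp
  qed
  have FTC: "(\<integral>\<^sup>+y. ennreal (exp (x - y) * (f y - f2 y)) * indicator {x..} y \<partial>lborel)
      = ennreal (0 - ?F x)"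
  proof (rule nn_integral_FTC_atLeast[where F = ?F])
  qed (use nonneg lim dF in auto)
  also have "(\<integral>\<^sup>+y. ennreal (exp (x - y) * (f y - f2 y)) * indicator {x..} y \<partial>lborel)
      = (\<integral>\<^sup>+y. ennreal (exp (x - y) * (f y - f2 y) * indicator {x..} y) \<partial>lborel)"
    by (intro nn_integral_cong) (auto simp: indicator_def)
  finally show "(\<integral>\<^sup>+y. ennreal (exp (x - y) * (f y - f2 y) * indicator {x..} y) \<partial>lborel)
      = ennreal (f x + f1 x)"
    by (simp add: add.commute)
  \<comment> \<open>\<open>ennreal\<close> truncates negative numbers, so the value from the
    fundamental theorem is usable only once its sign is known. It follows because \<open>?F\<close>
    is nondecreasing with limit 0.\<close>
  have "?F x \<le> 0"
  proof (rule tendsto_lowerbound[OF lim])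
    have "?F x \<le> ?F y" if "x \<le> y" for y
    proof (rule DERIV_nonneg_imp_nondecreasing[OF that])
      fix y
      show "\<exists>z. (?F has_real_derivative z) (at y) \<and> 0 \<le> z"
        using dF nonneg[of y] by (intro exI conjI) auto
    qed
    then show "\<forall>\<^sub>F y in at_top. ?F x \<le> ?F y"
      by (auto simp: eventually_at_top_linorder)
  qed simp
  then show "0 \<le> f x + f1 x" by simp
qed

text \<open>The kernel splits at \<open>x\<close> into two half-line integrals, with values
  \<open>f x + f1 x\<close> and \<open>f x - f1 x\<close>; the left one is the right one for the
  reflected function \<open>f (- y)\<close>. Averaging cancels \<open>f1\<close>.\<close>

lemma helmholtz_inv_eq:
  fixes f f1 f2 :: "real \<Rightarrow> real"
  assumes f: "\<And>x. (f has_real_derivative f1 x) (at x)" "\<And>x. (f1 has_real_derivative f2 x) (at x)"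
    and cont: "continuous_on UNIV f2"
    and bdd: "\<And>x. \<bar>f x\<bar> \<le> B" "\<And>x. \<bar>f1 x\<bar> \<le> B"
    and nonneg: "\<And>x. f2 x \<le> f x"
  shows "integrable lborel (\<lambda>y. exp (- \<bar>x - y\<bar>) / 2 * (f y - f2 y))"
    and "helmholtz_inv (\<lambda>x. f x - f2 x) x = f x"
proof -
  have right: "has_bochner_integral lborel
     (\<lambda>y. exp (x - y) * (f y - f2 y) * indicator {x..} y) (f x + f1 x)"
    by (rule has_bochner_integral_exp_half_line[OF assms])
  have "has_bochner_integral lborel
     (\<lambda>y. exp (- x - y) * (f (- y) - f2 (- y)) * indicator {- x..} y) (f (- (- x)) + - f1 (- (- x)))"
  proof (rule has_bochner_integral_exp_half_line[where B = B])
    show "((\<lambda>y. f (- y)) has_real_derivative - f1 (- y)) (at y)" for y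
      using DERIV_chain2[OF f(1) DERIV_minus[OF DERIV_ident]] by simp
    show "((\<lambda>y. - f1 (- y)) has_real_derivative f2 (- y)) (at y)" for y
      using DERIV_minus[OF DERIV_chain2[OF f(2) DERIV_minus[OF DERIV_ident]]] by simp
    show "continuous_on UNIV (\<lambda>y. f2 (- y))"
      by (rule continuous_on_compose2[OF cont]) (auto intro: continuous_intros)
  qed (use bdd nonneg in auto)
  from iffD1[OF lborel_has_bochner_integral_real_affine_iff[of "-1" _ _ 0] this]
  have left: "has_bochner_integral lborel
     (\<lambda>y. exp (y - x) * (f y - f2 y) * indicator {..x} y) (f x - f1 x)"
    by (simp add: indicator_def algebra_simps)
  have both: "has_bochner_integral lborel (\<lambda>y. (exp (x - y) * (f y - f2 y) * indicator {x..} y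
      + exp (y - x) * (f y - f2 y) * indicator {..x} y) / 2) ((f x + f1 x + (f x - f1 x)) / 2)"
    by (intro has_bochner_integral_divide_zero has_bochner_integral_add right left)
  \<comment> \<open>Both indicators count the point \<open>y = x\<close>, which is a null
    set.\<close>
  have ae: "AE y in lborel. (exp (x - y) * (f y - f2 y) * indicator {x..} y
      + exp (y - x) * (f y - f2 y) * indicator {..x} y) / 2 = exp (- \<bar>x - y\<bar>) / 2 * (f y - f2 y)"
    using AE_lborel_singleton[of x] by eventually_elim (auto simp: indicator_def)
  have meas: "(\<lambda>y. exp (- \<bar>x - y\<bar>) / 2 * (f y - f2 y)) \<in> borel_measurable lborel"
  proof -
    have cf: "continuous_on UNIV f"
      by (intro continuous_at_imp_continuous_on ballI DERIV_isCont[OF f(1)])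
    have [measurable]: "f \<in> borel_measurable borel" "f2 \<in> borel_measurable borel"
      by (intro borel_measurable_continuous_onI cf cont)+
    show ?thesis by measurable
  qed
  have "has_bochner_integral lborel (\<lambda>y. exp (- \<bar>x - y\<bar>) / 2 * (f y - f2 y)) (f x)"
    using has_bochner_integral_cong_AE[OF borel_measurable_has_bochner_integral[OF both] meas ae] both
    by simp
  then show "integrable lborel (\<lambda>y. exp (- \<bar>x - y\<bar>) / 2 * (f y - f2 y))"
    and "helmholtz_inv (\<lambda>x. f x - f2 x) x = f x"
    by (auto simp: has_bochner_integral_iff helmholtz_inv_def)
qed

text \<open>The constant function 1 in \<open>helmholtz_inv_eq\<close> gives the rate 1; scaling the
  variable gives every other rate.\<close>

lemma integrable_exp_minus_abs:
  fixes \<gamma> :: real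
  assumes "0 < \<gamma>"
  shows "integrable lborel (\<lambda>x. exp (- \<gamma> * \<bar>x\<bar>))"
proof -
  have "integrable lborel (\<lambda>y. exp (- \<bar>0 - y\<bar>) / 2 * (1 - 0 :: real))"
    by (rule helmholtz_inv_eq(1)[of _ "\<lambda>_. 0" _ 1]) auto
  then have "integrable lborel (\<lambda>y. 2 * (exp (- \<bar>y\<bar>) / 2) :: real)"
    by (intro integrable_mult_right) simp
  then have "integrable lborel (\<lambda>y. exp (- \<bar>y\<bar>) :: real)" by simp
  from lborel_integrable_real_affine[OF this, of \<gamma> 0]
  show ?thesis using assms by (simp add: abs_mult)
qed

subsection \<open>Exponential decay\<close>

text \<open>\<open>q = v' + \<beta> v\<close> satisfies \<open>q' \<ge> \<beta> q\<close>; as it tends to \<open>0\<close> it can never be positive,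
  which is a differential inequality of first order for \<open>v\<close>.\<close>

lemma exponential_decay:
  fixes v v1 v2 :: "real \<Rightarrow> real"
  assumes "0 < \<beta>"
    and v: "\<And>x. (v has_real_derivative v1 x) (at x)" "\<And>x. (v1 has_real_derivative v2 x) (at x)"
    and ineq: "\<And>x. X \<le> x \<Longrightarrow> \<beta>\<^sup>2 * v x \<le> v2 x"
    and lim: "(v \<longlongrightarrow> 0) at_top" "(v1 \<longlongrightarrow> 0) at_top"
    and "X \<le> x"
  shows "v x \<le> v X * exp (- \<beta> * (x - X))"
proof -
  define q where "q x = v1 x + \<beta> * v x" for x
  have q_lim: "(q \<longlongrightarrow> 0) at_top"
    unfolding q_def using tendsto_add[OF lim(2) tendsto_mult_left[OF lim(1), of \<beta>]] by simp
  have dq: "((\<lambda>x. exp (- \<beta> * x) * q x) has_real_derivative exp (- \<beta> * x) * (v2 x - \<beta>\<^sup>2 * v x)) (at x)" for x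
    unfolding q_def by (auto intro!: derivative_eq_intros v simp: algebra_simps power2_eq_square)
  have q_le: "q x \<le> 0" if "X \<le> x" for x
  proof (rule ccontr)
    assume "\<not> q x \<le> 0"
    then have pos: "0 < q x" by simp
    have "q x \<le> q y" if "x \<le> y" for y
    proof -
      have "exp (- \<beta> * x) * q x \<le> exp (- \<beta> * y) * q y"
      proof (rule DERIV_nonneg_imp_nondecreasing[OF that])
        fix z assume "x \<le> z"
        then have "0 \<le> exp (- \<beta> * z) * (v2 z - \<beta>\<^sup>2 * v z)"
          using ineq[of z] \<open>X \<le> x\<close> by simp
        with dq show "\<exists>d. ((\<lambda>x. exp (- \<beta> * x) * q x) has_real_derivative d) (at z) \<and> 0 \<le> d"
          by blast
      qed
      then have "exp (\<beta> * y) * (exp (- \<beta> * x) * q x) \<le> exp (\<beta> * y) * (exp (- \<beta> * y) * q y)"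
        by (rule mult_left_mono) simp
      then have "exp (\<beta> * (y - x)) * q x \<le> q y"
        by (simp add: mult.assoc[symmetric] exp_add[symmetric] right_diff_distrib)
      moreover have "1 * q x \<le> exp (\<beta> * (y - x)) * q x"
        using pos \<open>0 < \<beta>\<close> that by (intro mult_right_mono) auto
      ultimately show ?thesis by simp
    qed
    then have "q x \<le> 0"
      by (intro tendsto_lowerbound[OF q_lim]) (auto simp: eventually_at_top_linorder)
    with pos show False by simp
  qed
  \<comment> \<open>Since \<open>q \<le> 0\<close> means \<open>v1 \<le> - \<beta> * v\<close>, the
    function \<open>exp (\<beta> * x) * v x\<close> is nonincreasing; comparing its values at
    \<open>X\<close> and \<open>x\<close> is the claim.\<close>
  have "exp (\<beta> * x) * v x \<le> exp (\<beta> * X) * v X"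
  proof (rule DERIV_nonpos_imp_nonincreasing[OF \<open>X \<le> x\<close>])
    fix y assume "X \<le> y"
    have "((\<lambda>x. exp (\<beta> * x) * v x) has_real_derivative exp (\<beta> * y) * q y) (at y)"
      unfolding q_def by (auto intro!: derivative_eq_intros v simp: algebra_simps)
    moreover have "exp (\<beta> * y) * q y \<le> 0"
      using q_le[OF \<open>X \<le> y\<close>] by (simp add: mult_nonneg_nonpos)
    ultimately show "\<exists>z. ((\<lambda>x. exp (\<beta> * x) * v x) has_real_derivative z) (at y) \<and> z \<le> 0"
      by blast
  qed
  then have "exp (- \<beta> * x) * (exp (\<beta> * x) * v x) \<le> exp (- \<beta> * x) * (exp (\<beta> * X) * v X)"
    by (rule mult_left_mono) simp
  then show ?thesis
    by (simp add: mult.assoc[symmetric] exp_add[symmetric] right_diff_distrib mult.commute[of "v X"])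
qed

subsection \<open>The first variation of the action\<close>

lemma smooth_has_derivative:
  assumes "smooth f"
  shows "((deriv ^^ n) f has_real_derivative (deriv ^^ Suc n) f x) (at x)"
proof -
  have "(deriv ^^ n) f differentiable (at x)"
    using assms unfolding smooth_def by (auto simp: differentiable_on_def)
  then show ?thesis
    by (simp add: DERIV_deriv_iff_real_differentiable)
qed

lemma smooth_deriv_continuous:
  assumes "smooth f"
  shows "continuous_on UNIV ((deriv ^^ n) f)"
  by (intro continuous_at_imp_continuous_on ballI DERIV_isCont[OF smooth_has_derivative[OF assms]])

lemma test_function_vanishes_outside:
  assumes "test_function h"
  obtains R where "0 < R" "\<And>x. R \<le> \<bar>x\<bar> \<Longrightarrow> h x = 0" "\<And>x. R \<le> \<bar>x\<bar> \<Longrightarrow> deriv h x = 0"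
proof -
  have "bounded {x. h x \<noteq> 0}"
    using assms unfolding test_function_def
    by (intro bounded_subset[OF compact_imp_bounded closure_subset]) simp
  then obtain B where B: "\<And>x. h x \<noteq> 0 \<Longrightarrow> \<bar>x\<bar> \<le> B"
    unfolding bounded_iff by auto
  have B0: "h x = 0" if "B < \<bar>x\<bar>" for x
    using B that by force
  show thesis
  \<comment> \<open>The extra 1 places all points in question inside the open set
    \<open>B < \<bar>y\<bar>\<close>, where \<open>h\<close> vanishes, so that
    \<open>deriv h\<close> vanishes there as well. The non-strict bound also makes \<open>h\<close>
    zero at the endpoints \<open>R\<close> and \<open>- R\<close>.\<close>
  proof (rule that[of "\<bar>B\<bar> + 1"])
    show "deriv h x = 0" if "\<bar>B\<bar> + 1 \<le> \<bar>x\<bar>" for x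
    proof (rule DERIV_imp_deriv)
      have "open {y::real. B < \<bar>y\<bar>}"
        by (intro open_Collect_less continuous_intros)
      then have "\<forall>\<^sub>F y in nhds x. h y = 0"
        using eventually_nhds_in_open[of "{y. B < \<bar>y\<bar>}" x] that B0
        by (force elim: eventually_mono)
      then show "(h has_real_derivative 0) (at x)"
        by (subst DERIV_cong_ev[OF refl _ refl]) auto
    qed
  qed (auto intro: B0)
qed

section \<open>Membership of perturbed functions in \<open>X_space\<close>\<close>

lemma sobolev_H1I:
  assumes f: "\<And>x. (f has_real_derivative f' x) (at x)" "continuous_on UNIV f'"
    and int: "integrable lborel (\<lambda>x. (f x)\<^sup>2)" "integrable lborel (\<lambda>x. (f' x)\<^sup>2)"
  shows "f \<in> sobolev_H1"
proof -
  have d: "deriv f = f'"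
    by (intro ext DERIV_imp_deriv f)
  have si: "set_integrable lborel {a..b} f'" for a b
    by (intro borel_integrable_atLeastAtMost' continuous_on_subset[OF f(2)]) auto
  have "f b - f a = (LINT x:{a..b}|lborel. f' x)" if "a \<le> b" for a b
  proof -
    have "(f' has_integral f b - f a) {a..b}"
      using that f(1) by (intro fundamental_theorem_of_calculus)
        (auto simp: has_real_derivative_iff_has_vector_derivative[symmetric]
          intro: has_field_derivative_at_within)
    then show ?thesis
      using set_borel_integral_eq_integral(2)[OF si] by (metis integral_unique)
  qed
  with si int show ?thesis
    by (auto simp: sobolev_H1_def d)
qed

lemma X_space_variation:
  assumes m: "\<And>x. (m has_real_derivative m1 x) (at x)" "continuous_on UNIV m1"
    and h: "\<And>x. (h has_real_derivative h1 x) (at x)" "continuous_on UNIV h1"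
    and int: "integrable lborel (\<lambda>x. (m x - k)\<^sup>2)" "integrable lborel (\<lambda>x. (m1 x)\<^sup>2)"
    and supp: "\<And>x. R < \<bar>x\<bar> \<Longrightarrow> h x = 0" "\<And>x. R < \<bar>x\<bar> \<Longrightarrow> h1 x = 0"
    and pos: "\<And>x. 0 < m x + e * h x"
  shows "(\<lambda>x. m x + e * h x) \<in> X_space k"
proof -
  have cm: "continuous_on UNIV m" and ch: "continuous_on UNIV h"
    by (intro continuous_at_imp_continuous_on ballI DERIV_isCont[OF m(1)] DERIV_isCont[OF h(1)])+
  have "(\<lambda>x. m x - k + e * h x) \<in> sobolev_H1"
  proof (rule sobolev_H1I)
    show "((\<lambda>x. m x - k + e * h x) has_real_derivative m1 x + e * h1 x) (at x)" for x
      by (auto intro!: derivative_eq_intros m h)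
    show "continuous_on UNIV (\<lambda>x. m1 x + e * h1 x)"
      by (intro continuous_intros m h)
    show "integrable lborel (\<lambda>x. (m x - k + e * h x)\<^sup>2)"
      by (intro integrable_power2_add int integrable_compact_support(1)[where R = R]
          borel_measurable_continuous_onI continuous_intros cm ch) (simp add: supp)
    show "integrable lborel (\<lambda>x. (m1 x + e * h1 x)\<^sup>2)"
      by (intro integrable_power2_add int integrable_compact_support(1)[where R = R]
          borel_measurable_continuous_onI continuous_intros m h) (simp add: supp)
  qed
  then show ?thesis
    using pos by (simp add: X_space_def algebra_simps)
qed

section \<open>Derivatives of the three functionals along a test function\<close>

lemma F1_variation:
  assumes "0 < r" and cont: "continuous_on UNIV m" "continuous_on UNIV h"
    and pos: "\<And>e x. \<bar>e\<bar> < r \<Longrightarrow> 0 < m x + e * h x"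
    and supp: "\<And>x. R < \<bar>x\<bar> \<Longrightarrow> h x = 0"
    and int: "integrable lborel (F1_density k m)"
  shows "\<And>e. \<bar>e\<bar> < r \<Longrightarrow> integrable lborel (F1_density k (\<lambda>x. m x + e * h x))"
    and "((\<lambda>e. F1 k (\<lambda>x. m x + e * h x)) has_real_derivative
       integral {-R..R} (\<lambda>x. 2/3 * m x powr (-1/3) * h x)) (at 0)"
proof -
  define L where "L e x = (m x + e * h x) powr (2/3) - k powr (2/3)" for e x
  have L: "F1_density k (\<lambda>x. m x + e * h x) = L e" for e
    by (simp add: fun_eq_iff F1_density_def L_def)
  define L' where "L' e x = 2/3 * (m x + e * h x) powr (-1/3) * h x" for e x
  have 1: "((\<lambda>e. L e x) has_real_derivative L' e x) (at e)" if "\<bar>e\<bar> < r" for e x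
    unfolding L_def L'_def
    using pos[OF that, of x] by (auto intro!: derivative_eq_intros)
  have sub: "continuous_on A m" "continuous_on A h" for A
    by (auto intro: continuous_on_subset[OF cont(1)] continuous_on_subset[OF cont(2)])
  \<comment> \<open>The continuity rule for \<open>powr\<close> asks for a nonzero base; positivity
    for \<open>\<bar>e\<bar> < r\<close> supplies it on the whole strip.\<close>
  have nz: "\<forall>p\<in>{-r<..<r} \<times> {-R..R}. m (snd p) + fst p * h (snd p) \<noteq> 0"
  proof
    fix p assume "p \<in> {-r<..<r} \<times> {-R..R}"
    then show "m (snd p) + fst p * h (snd p) \<noteq> 0"
      using pos[of "fst p" "snd p"] by (auto simp: abs_less_iff)
  qed
  have 2: "continuous_on ({-r<..<r} \<times> {-R..R}) (\<lambda>(e, x). L' e x)"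
    unfolding L'_def case_prod_unfold
    by (intro continuous_intros continuous_on_compose2[OF cont(1)] continuous_on_compose2[OF cont(2)])
       (use nz in auto)
  have 3: "continuous_on {-R..R} (L e)" if "\<bar>e\<bar> < r" for e
    unfolding L_def
    by (intro continuous_intros sub) (use pos[OF that] in \<open>auto simp: less_imp_neq[symmetric]\<close>)
  have 4: "L e x = L 0 x" if "R < \<bar>x\<bar>" for e x
    using supp[OF that] by (simp add: L_def)
  have 5: "integrable lborel (L 0)"
    using int L[of 0] by simp
  have var1: "integrable lborel (L e)" if "\<bar>e\<bar> < r" for e
    by (rule LINT_compact_variation(1)[OF \<open>0 < r\<close> 1 2 3 4 5 that])
  have var2: "((\<lambda>e. LINT x|lborel. L e x) has_real_derivative integral {-R..R} (L' 0)) (at 0)"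
    by (rule LINT_compact_variation(2)[OF \<open>0 < r\<close> 1 2 3 4 5])
  show "integrable lborel (F1_density k (\<lambda>x. m x + e * h x))" if "\<bar>e\<bar> < r" for e
    using var1[OF that] by (simp add: L)
  show "((\<lambda>e. F1 k (\<lambda>x. m x + e * h x)) has_real_derivative
       integral {-R..R} (\<lambda>x. 2/3 * m x powr (-1/3) * h x)) (at 0)"
    using var2 by (simp add: L L'_def[abs_def] F1_def)
qed

lemma F2_variation:
  assumes "0 < r"
    and m: "\<And>x. (m has_real_derivative m1 x) (at x)" "continuous_on UNIV m1"
    and h: "\<And>x. (h has_real_derivative h1 x) (at x)" "continuous_on UNIV h1"
    and pos: "\<And>e x. \<bar>e\<bar> < r \<Longrightarrow> 0 < m x + e * h x"
    and supp: "\<And>x. R < \<bar>x\<bar> \<Longrightarrow> h x = 0" "\<And>x. R < \<bar>x\<bar> \<Longrightarrow> h1 x = 0"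
    and int: "integrable lborel (F2_density k m)"
  shows "\<And>e. \<bar>e\<bar> < r \<Longrightarrow> integrable lborel (F2_density k (\<lambda>x. m x + e * h x))"
    and "((\<lambda>e. F2 k (\<lambda>x. m x + e * h x)) has_real_derivative
       integral {-R..R} (\<lambda>x. - 8/3 * m x powr (-11/3) * h x * (m1 x)\<^sup>2
         + 2 * m x powr (-8/3) * m1 x * h1 x - 6 * m x powr (-5/3) * h x)) (at 0)"
proof -
  have cont: "continuous_on UNIV m" "continuous_on UNIV h"
    by (intro continuous_at_imp_continuous_on ballI DERIV_isCont[OF m(1)] DERIV_isCont[OF h(1)])+
  have d: "deriv (\<lambda>x. m x + e * h x) x = m1 x + e * h1 x" for e x
    by (rule DERIV_imp_deriv) (auto intro!: derivative_eq_intros m h)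
  define L where "L e x = (m x + e * h x) powr (-8/3) * (m1 x + e * h1 x)\<^sup>2
      + 9 * ((m x + e * h x) powr (-2/3) - k powr (-2/3))" for e x
  have L: "F2_density k (\<lambda>x. m x + e * h x) = L e" for e
    by (simp add: fun_eq_iff F2_density_def L_def d)
  define L' where "L' e x = - 8/3 * (m x + e * h x) powr (-11/3) * h x * (m1 x + e * h1 x)\<^sup>2
         + 2 * (m x + e * h x) powr (-8/3) * (m1 x + e * h1 x) * h1 x
         - 6 * (m x + e * h x) powr (-5/3) * h x" for e x
  have 1: "((\<lambda>e. L e x) has_real_derivative L' e x) (at e)" if "\<bar>e\<bar> < r" for e x
    unfolding L_def L'_def
    using pos[OF that, of x] by (auto intro!: derivative_eq_intros simp: algebra_simps)
  have sub: "continuous_on A m" "continuous_on A h" "continuous_on A m1" "continuous_on A h1" for A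
    by (auto intro: cont[THEN continuous_on_subset] m(2)[THEN continuous_on_subset]
        h(2)[THEN continuous_on_subset])
  have nz: "\<forall>p\<in>{-r<..<r} \<times> {-R..R}. m (snd p) + fst p * h (snd p) \<noteq> 0"
  proof
    fix p assume "p \<in> {-r<..<r} \<times> {-R..R}"
    then show "m (snd p) + fst p * h (snd p) \<noteq> 0"
      using pos[of "fst p" "snd p"] by (auto simp: abs_less_iff)
  qed
  have 2: "continuous_on ({-r<..<r} \<times> {-R..R}) (\<lambda>(e, x). L' e x)"
    unfolding L'_def case_prod_unfold
    by (intro continuous_intros continuous_on_compose2[OF cont(1)] continuous_on_compose2[OF cont(2)]
        continuous_on_compose2[OF m(2)] continuous_on_compose2[OF h(2)])
       (use nz in auto)
  have 3: "continuous_on {-R..R} (L e)" if "\<bar>e\<bar> < r" for e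
    unfolding L_def
    by (intro continuous_intros sub) (use pos[OF that] in \<open>auto simp: less_imp_neq[symmetric]\<close>)
  have 4: "L e x = L 0 x" if "R < \<bar>x\<bar>" for e x
    using supp[OF that] by (simp add: L_def)
  have 5: "integrable lborel (L 0)"
    using int L[of 0] by simp
  have var1: "integrable lborel (L e)" if "\<bar>e\<bar> < r" for e
    by (rule LINT_compact_variation(1)[OF \<open>0 < r\<close> 1 2 3 4 5 that])
  have var2: "((\<lambda>e. LINT x|lborel. L e x) has_real_derivative integral {-R..R} (L' 0)) (at 0)"
    by (rule LINT_compact_variation(2)[OF \<open>0 < r\<close> 1 2 3 4 5])
  show "integrable lborel (F2_density k (\<lambda>x. m x + e * h x))" if "\<bar>e\<bar> < r" for e
    using var1[OF that] by (simp add: L)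
  show "((\<lambda>e. F2 k (\<lambda>x. m x + e * h x)) has_real_derivative
       integral {-R..R} (\<lambda>x. - 8/3 * m x powr (-11/3) * h x * (m1 x)\<^sup>2
         + 2 * m x powr (-8/3) * m1 x * h1 x - 6 * m x powr (-5/3) * h x)) (at 0)"
    using var2 by (simp add: L L'_def[abs_def] F2_def)
qed

text \<open>\<open>helmholtz_inv\<close> is symmetric, so the term of first order in \<open>e\<close> is twice the integral of
  \<open>helmholtz_inv m * h\<close>.\<close>

lemma energy_variation:
  assumes m: "continuous_on UNIV m" "0 < \<alpha>" "\<And>x. \<alpha> \<le> m x"
    and kernel: "\<And>x. integrable lborel (\<lambda>y. exp (- \<bar>x - y\<bar>) / 2 * m y)"
    and cont: "continuous_on UNIV (helmholtz_inv m)"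
    and h: "continuous_on UNIV h" "\<And>x. R < \<bar>x\<bar> \<Longrightarrow> h x = 0"
    and int: "integrable lborel (energy_density k m)"
  shows "\<And>e. integrable lborel (energy_density k (\<lambda>x. m x + e * h x))"
    and "((\<lambda>e. energy k (\<lambda>x. m x + e * h x)) has_real_derivative
       integral {-R..R} (\<lambda>x. 2 * helmholtz_inv m x * h x)) (at 0)"
proof -
  let ?K = "helmholtz_inv"
  have [measurable]: "m \<in> borel_measurable borel" "h \<in> borel_measurable borel"
    by (intro borel_measurable_continuous_onI m h)+
  have kernel_h: "integrable lborel (\<lambda>y. exp (- \<bar>x - y\<bar>) / 2 * h y)" for x
    by (intro integrable_compact_support(1)[where R = R] continuous_intros h) (simp_all add: h)
  have K_add: "?K (\<lambda>x. m x + e * h x) x = ?K m x + e * ?K h x" for e x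
  proof -
    have "?K (\<lambda>x. m x + e * h x) x
        = (LINT y|lborel. exp (- \<bar>x - y\<bar>) / 2 * m y + e * (exp (- \<bar>x - y\<bar>) / 2 * h y))"
      unfolding helmholtz_inv_def by (intro Bochner_Integration.integral_cong) (auto simp: algebra_simps)
    also have "\<dots> = ?K m x + e * ?K h x"
      unfolding helmholtz_inv_def
      by (subst Bochner_Integration.integral_add[OF kernel integrable_mult_right[OF kernel_h]]) simp
    finally show ?thesis .
  qed
  have m_pos: "0 < m x" for x
    using m(2) m(3)[of x] by simp
  have K_nonneg: "0 \<le> ?K m x" for x
    unfolding helmholtz_inv_def
    by (intro Bochner_Integration.integral_nonneg mult_nonneg_nonneg less_imp_le[OF m_pos]) simp
  have Kmh: "integrable lborel (\<lambda>x. ?K m x * h x)"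
    and Kmh_val: "(LINT x|lborel. ?K m x * h x) = integral {-R..R} (\<lambda>x. ?K m x * h x)"
    using integrable_compact_support[of "\<lambda>x. ?K m x * h x" R] h(2)
    by (auto intro!: continuous_intros cont h)
  \<comment> \<open>Integrating \<open>?f\<close> over \<open>x\<close> gives
    \<open>?K m y * h y\<close>, integrating over \<open>y\<close> gives
    \<open>m x * ?K h x\<close>; Fubini equates the two iterated integrals.\<close>
  let ?f = "\<lambda>y x. exp (- \<bar>y - x\<bar>) / 2 * m x * h y"
  have prod: "integrable (lborel \<Otimes>\<^sub>M lborel) (\<lambda>(y, x). ?f y x)"
  proof (rule lborel_pair.Fubini_integrable)
    show "(\<lambda>(y, x). ?f y x) \<in> borel_measurable (lborel \<Otimes>\<^sub>M lborel)"
      by measurable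
    \<comment> \<open>Because \<open>m\<close> is positive, taking absolute values only replaces
      \<open>h\<close> by its modulus, and the result is the modulus of the integrable function
      \<open>?K m y * h y\<close>.\<close>
    have "(\<lambda>y. LINT x|lborel. norm (case (y, x) of (y, x) \<Rightarrow> ?f y x)) = (\<lambda>y. norm (?K m y * h y))"
    proof
      fix y
      have "(LINT x|lborel. norm (case (y, x) of (y, x) \<Rightarrow> ?f y x))
          = (LINT x|lborel. exp (- \<bar>y - x\<bar>) / 2 * m x * \<bar>h y\<bar>)"
        by (intro Bochner_Integration.integral_cong) (simp_all add: abs_mult abs_of_pos[OF m_pos])
      also have "\<dots> = ?K m y * \<bar>h y\<bar>"
        unfolding helmholtz_inv_def by (rule integral_mult_left_zero)
      finally show "(LINT x|lborel. norm (case (y, x) of (y, x) \<Rightarrow> ?f y x)) = norm (?K m y * h y)"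
        using K_nonneg[of y] by (simp add: abs_mult)
    qed
    then show "integrable lborel (\<lambda>y. LINT x|lborel. norm (case (y, x) of (y, x) \<Rightarrow> ?f y x))"
      using Kmh by simp
    show "AE y in lborel. integrable lborel (\<lambda>x. case (y, x) of (y, x) \<Rightarrow> ?f y x)"
      unfolding prod.case by (intro AE_I2 integrable_mult_left kernel)
  qed
  have inner: "(LINT y|lborel. ?f y x) = m x * ?K h x" for x
    unfolding helmholtz_inv_def
    by (subst integral_mult_right_zero[symmetric], intro Bochner_Integration.integral_cong)
       (auto simp: abs_minus_commute algebra_simps)
  have mKh: "integrable lborel (\<lambda>x. m x * ?K h x)"
    using lborel_pair.integrable_snd[OF prod] by (simp only: inner)
  have "(LINT x|lborel. m x * ?K h x) = (LINT y|lborel. LINT x|lborel. ?f y x)"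
    using lborel_pair.Fubini_integral[OF prod] by (simp only: inner)
  also have "\<dots> = (LINT y|lborel. ?K m y * h y)"
    unfolding helmholtz_inv_def by (intro Bochner_Integration.integral_cong refl integral_mult_left_zero)
  finally have symm: "(LINT x|lborel. m x * ?K h x) = (LINT y|lborel. ?K m y * h y)" .
  \<comment> \<open>The lower bound \<open>\<alpha>\<close> makes \<open>h / m\<close> bounded, so
    this follows from the integrability of \<open>m x * ?K h x\<close>.\<close>
  have hKh: "integrable lborel (\<lambda>x. h x * ?K h x)"
  proof -
    obtain B where B: "0 < B" "\<And>x. \<bar>h x\<bar> \<le> B"
      using compact_support_bounded[OF h] by blast
    have "\<bar>h x / m x\<bar> \<le> B / \<alpha>" for x
      using m(2) m(3)[of x] B by (auto simp: abs_divide intro!: frac_le)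
    then have "integrable lborel (\<lambda>x. h x / m x * (m x * ?K h x))"
      by (intro integrable_bounded_mult[OF mKh]) auto
    moreover have "h x / m x * (m x * ?K h x) = h x * ?K h x" for x
      using m_pos[of x] by simp
    ultimately show ?thesis by simp
  qed
  \<comment> \<open>The density is exactly a quadratic polynomial in \<open>e\<close>, so the
    derivative at 0 is read off from its linear coefficient.\<close>
  have dens: "energy_density k (\<lambda>x. m x + e * h x) = (\<lambda>x. energy_density k m x
      + e * (?K m x * h x + m x * ?K h x) + e\<^sup>2 * (h x * ?K h x))" for e
    by (auto simp: energy_density_def K_add algebra_simps power2_eq_square)
  show "integrable lborel (energy_density k (\<lambda>x. m x + e * h x))" for e
    unfolding dens
    by (intro Bochner_Integration.integrable_add integrable_mult_right int Kmh mKh hKh)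
  have "energy k (\<lambda>x. m x + e * h x) = energy k m
      + e * (2 * (LINT x|lborel. ?K m x * h x)) + e\<^sup>2 * (LINT x|lborel. h x * ?K h x)" for e
    unfolding energy_def dens using int Kmh mKh hKh symm by simp
  moreover have "((\<lambda>e. energy k m + e * (2 * (LINT x|lborel. ?K m x * h x))
      + e\<^sup>2 * (LINT x|lborel. h x * ?K h x)) has_real_derivative
      2 * (LINT x|lborel. ?K m x * h x)) (at 0)"
    by (auto intro!: derivative_eq_intros)
  ultimately show "((\<lambda>e. energy k (\<lambda>x. m x + e * h x)) has_real_derivative
       integral {-R..R} (\<lambda>x. 2 * ?K m x * h x)) (at 0)"
    by (simp add: Kmh_val mult.assoc)
qed

text \<open>Gathers the analytic properties of \<open>m\<close> under which the pointwise
  Euler-Lagrange equation implies criticality for the functional, including membership of all small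
  perturbations in \<open>action_domain\<close>.\<close>

lemma critical_point_actionI:
  assumes m: "\<And>x. (m has_real_derivative m1 x) (at x)" "\<And>x. (m1 has_real_derivative m2 x) (at x)"
    and pos: "0 < \<alpha>" "\<And>x. \<alpha> \<le> m x"
    and kernel: "\<And>x. integrable lborel (\<lambda>y. exp (- \<bar>x - y\<bar>) / 2 * m y)"
    and contK: "continuous_on UNIV (helmholtz_inv m)"
    and H1: "integrable lborel (\<lambda>x. (m x - k)\<^sup>2)" "integrable lborel (\<lambda>x. (m1 x)\<^sup>2)"
    and dens: "integrable lborel (energy_density k m)" "integrable lborel (F1_density k m)"
      "integrable lborel (F2_density k m)"
    and grad: "\<And>x. action_gradient \<omega>0 \<omega>1 m x = 0"
  shows "critical_point (action_domain k) (action k \<omega>0 \<omega>1) m"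
proof -
  have cm: "continuous_on UNIV m" and cm1: "continuous_on UNIV m1"
    by (intro continuous_at_imp_continuous_on ballI DERIV_isCont[OF m(1)] DERIV_isCont[OF m(2)])+
  have m_pos: "0 < m x" for x
    using pos(1) pos(2)[of x] by simp
  \<comment> \<open>The trivial perturbation shows that \<open>m\<close> itself lies in
    \<open>X_space k\<close>.\<close>
  have "(\<lambda>x. m x + 0 * 0) \<in> X_space k"
    by (rule X_space_variation[of m m1 "\<lambda>_. 0" "\<lambda>_. 0" k 0]) (use m cm1 H1 m_pos in auto)
  then have mD: "m \<in> action_domain k"
    using dens by (simp add: action_domain_def)
  have "(\<forall>\<^sub>F e in nhds 0. (\<lambda>x. m x + e * h x) \<in> action_domain k) \<and>
      ((\<lambda>e. action k \<omega>0 \<omega>1 (\<lambda>x. m x + e * h x)) has_real_derivative 0) (at 0)"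
    if test: "test_function h" for h
  proof -
    define h1 where "h1 = deriv h"
    have h: "(h has_real_derivative h1 x) (at x)" for x
      using smooth_has_derivative[of h 0 x] test by (simp add: test_function_def h1_def)
    have ch: "continuous_on UNIV h" and ch1: "continuous_on UNIV h1"
      using smooth_deriv_continuous[of h 0] smooth_deriv_continuous[of h 1] test
      by (simp_all add: test_function_def h1_def)
    obtain R where R: "0 < R" "\<And>x. R \<le> \<bar>x\<bar> \<Longrightarrow> h x = 0" "\<And>x. R \<le> \<bar>x\<bar> \<Longrightarrow> h1 x = 0"
      using test_function_vanishes_outside[OF test] unfolding h1_def by blast
    have supp: "h x = 0" "h1 x = 0" if "R < \<bar>x\<bar>" for x
      using R(2,3)[of x] that by simp_all
    obtain B where B: "0 < B" "\<And>x. \<bar>h x\<bar> \<le> B"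
      using compact_support_bounded[OF ch supp(1)] by blast
    \<comment> \<open>With \<open>\<bar>h x\<bar> \<le> B\<close>, this radius ensures
      \<open>\<bar>e * h x\<bar> < \<alpha> \<le> m x\<close>, so the perturbation stays
      positive.\<close>
    define r where "r = \<alpha> / B"
    have "0 < r"
      using pos B by (simp add: r_def)
    have m_h_pos: "0 < m x + e * h x" if "\<bar>e\<bar> < r" for e x
    proof -
      have "\<bar>e * h x\<bar> \<le> \<bar>e\<bar> * B"
        unfolding abs_mult by (intro mult_left_mono B) simp
      also have "\<dots> < r * B"
        using that B by simp
      also have "\<dots> \<le> m x"
        using pos(2) B by (simp add: r_def)
      finally show ?thesis by simp
    qed
    note v0 = energy_variation[OF cm pos kernel contK ch supp(1) dens(1)]
    note v1 = F1_variation[OF \<open>0 < r\<close> cm ch m_h_pos supp(1) dens(2)]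
    note v2 = F2_variation[OF \<open>0 < r\<close> m(1) cm1 h ch1 m_h_pos supp dens(3)]
    have "(\<lambda>x. m x + e * h x) \<in> action_domain k" if "\<bar>e\<bar> < r" for e
      unfolding action_domain_def
      using X_space_variation[OF m(1) cm1 h ch1 H1 supp m_h_pos[OF that]] v0(1) v1(1) v2(1) that
      by simp
    moreover have "\<forall>\<^sub>F e in nhds 0. \<bar>e\<bar> < r"
      using eventually_nhds_in_open[of "{-r<..<r}" 0] \<open>0 < r\<close>
      by (auto elim!: eventually_mono)
    ultimately have ev: "\<forall>\<^sub>F e in nhds 0. (\<lambda>x. m x + e * h x) \<in> action_domain k"
      by (auto elim!: eventually_mono)
    let ?f0 = "\<lambda>x. 2 * helmholtz_inv m x * h x"
    let ?f1 = "\<lambda>x. 2/3 * m x powr (-1/3) * h x"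
    let ?f2 = "\<lambda>x. - 8/3 * m x powr (-11/3) * h x * (m1 x)\<^sup>2
         + 2 * m x powr (-8/3) * m1 x * h1 x - 6 * m x powr (-5/3) * h x"
    let ?P = "\<lambda>x. 2 * m x powr (-8/3) * m1 x * h x"
    have int: "?f0 integrable_on {-R..R}" "?f1 integrable_on {-R..R}" "?f2 integrable_on {-R..R}"
      by (intro integrable_continuous_real continuous_intros;
          use m_pos in \<open>auto simp: less_imp_neq[symmetric] intro: continuous_on_subset[OF cm]
            continuous_on_subset[OF cm1] continuous_on_subset[OF ch] continuous_on_subset[OF ch1]
            continuous_on_subset[OF contK]\<close>)+
    \<comment> \<open>\<open>?P\<close> is the boundary term from integrating the \<open>h1\<close>
      term of \<open>?f2\<close> by parts. Its derivative is the first variation minus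
      \<open>action_gradient\<close> times \<open>h\<close>, and the gradient vanishes by
      \<open>grad\<close>; at \<open>R\<close> and \<open>- R\<close> the factor \<open>h\<close>
      makes \<open>?P\<close> zero.\<close>
    have "((\<lambda>x. \<omega>0 * ?f0 x + \<omega>1 * ?f1 x + ?f2 x) has_integral ?P R - ?P (-R)) {-R..R}"
    proof (rule fundamental_theorem_of_calculus)
      fix x
      have powr: "m x powr (-8/3 - 1) = m x powr (-11/3)"
        by (rule arg_cong) simp
      have inv: "1 / m x powr (1/3) = m x powr (-1/3)" "1 / m x powr (11/3) = m x powr (-11/3)"
        by (simp_all add: powr_minus_divide)
      have "(?P has_real_derivative 2 * (-8/3 * m x powr (-11/3) * (m1 x)\<^sup>2 * h x
          + m x powr (-8/3) * m2 x * h x + m x powr (-8/3) * m1 x * h1 x)) (at x)"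
        using m_pos[of x]
        by (auto intro!: derivative_eq_intros m h simp: powr algebra_simps power2_eq_square)
      also have "2 * (-8/3 * m x powr (-11/3) * (m1 x)\<^sup>2 * h x
          + m x powr (-8/3) * m2 x * h x + m x powr (-8/3) * m1 x * h1 x)
          = \<omega>0 * ?f0 x + \<omega>1 * ?f1 x + ?f2 x - action_gradient \<omega>0 \<omega>1 m x * h x"
      proof -
        have "deriv m = m1" "deriv m1 = m2"
          by (auto intro!: DERIV_imp_deriv m)
        then have g: "action_gradient \<omega>0 \<omega>1 m x = 2 * \<omega>0 * helmholtz_inv m x
            + 2 * \<omega>1 / 3 * (1 / m x powr (1/3)) - 2 * m x powr (-8/3) * m2 x
            - 6 * m x powr (-5/3) + 8 / 3 * (m1 x)\<^sup>2 * (1 / m x powr (11/3))"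
          by (simp add: action_gradient_def)
        show ?thesis
          unfolding g inv by (simp add: algebra_simps)
      qed
      finally show "(?P has_vector_derivative \<omega>0 * ?f0 x + \<omega>1 * ?f1 x + ?f2 x) (at x within {-R..R})"
        using grad[of x]
        by (auto simp: has_real_derivative_iff_has_vector_derivative[symmetric]
            intro: has_field_derivative_at_within)
    qed (use R in simp)
    moreover have "((\<lambda>x. \<omega>0 * ?f0 x + \<omega>1 * ?f1 x + ?f2 x) has_integral
        \<omega>0 * integral {-R..R} ?f0 + \<omega>1 * integral {-R..R} ?f1 + integral {-R..R} ?f2) {-R..R}"
      by (intro has_integral_add has_integral_mult_right integrable_integral int)
    ultimately have "\<omega>0 * integral {-R..R} ?f0 + \<omega>1 * integral {-R..R} ?f1 + integral {-R..R} ?f2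
        = ?P R - ?P (-R)"
      using has_integral_unique by blast
    also have "\<dots> = 0"
      using R by simp
    finally have zero: "\<omega>0 * integral {-R..R} ?f0 + \<omega>1 * integral {-R..R} ?f1 + integral {-R..R} ?f2 = 0" .
    have "((\<lambda>e. action k \<omega>0 \<omega>1 (\<lambda>x. m x + e * h x)) has_real_derivative
        \<omega>0 * integral {-R..R} ?f0 + \<omega>1 * integral {-R..R} ?f1 + integral {-R..R} ?f2) (at 0)"
      unfolding action_def
      by (intro DERIV_add DERIV_cmult v0(2) v1(2) v2(2))
    with ev show ?thesis
      unfolding zero by blast
  qed
  then show ?thesis
    unfolding critical_point_def has_variational_derivative_def using mD by simp
qed

subsection \<open>The solitary wave\<close>

text \<open>Converts half-integral powers of \<open>c - \<phi>\<^sup>2\<close> into integer powers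
  of its square root, to which field arithmetic applies.\<close>

lemma powr_neg_half_int:
  fixes s :: real
  assumes "0 < s"
  shows "s powr (- real n / 2) = 1 / sqrt s ^ n"
proof -
  have "s powr (- real n / 2) = (s powr (1/2)) powr (- real n)"
    by (simp add: powr_powr)
  also have "\<dots> = 1 / sqrt s ^ n"
    using assms by (simp add: powr_half_sqrt powr_minus_divide powr_realpow)
  finally show ?thesis .
qed

lemma cube_powr_third:
  fixes t :: real
  assumes "0 < t"
  shows "(t ^ 3) powr (x / 3) = t powr x"
proof -
  have "(t ^ 3) powr (x / 3) = (t powr 3) powr (x / 3)"
    using assms by simp
  then show ?thesis by (simp only: powr_powr) simp
qed

text \<open>The increments of a convergent function over unit intervals tend to 0, and by the mean
  value theorem each is a value of \<open>f'\<close>. The square appears because the energy integral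
  controls only the square of \<open>\<phi>1\<close>.\<close>

lemma tendsto_imp_derivative_power2_limit_0:
  fixes f :: "real \<Rightarrow> real"
  assumes f: "\<And>x. (f has_real_derivative f' x) (at x)"
    and lim: "(f \<longlongrightarrow> l) at_top" "((\<lambda>x. (f' x)\<^sup>2) \<longlongrightarrow> L) at_top"
  shows "L = 0"
proof (rule ccontr)
  assume "L \<noteq> 0"
  have "0 \<le> L"
    by (rule tendsto_lowerbound[OF lim(2)]) auto
  with \<open>L \<noteq> 0\<close> have "0 < L" by simp
  have ev1: "\<forall>\<^sub>F x in at_top. L / 2 < (f' x)\<^sup>2"
    by (rule order_tendstoD(1)[OF lim(2)]) (use \<open>0 < L\<close> in simp)
  have "filterlim (\<lambda>x. x + 1) at_top (at_top :: real filter)"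
    by (rule filterlim_tendsto_add_at_top[OF tendsto_const filterlim_ident, of 1, simplified add.commute])
  then have "((\<lambda>x. f (x + 1)) \<longlongrightarrow> l) at_top"
    by (rule filterlim_compose[OF lim(1)])
  then have "((\<lambda>x. (f (x + 1) - f x)\<^sup>2) \<longlongrightarrow> (l - l)\<^sup>2) at_top"
    by (intro tendsto_intros lim(1))
  then have ev2: "\<forall>\<^sub>F x in at_top. (f (x + 1) - f x)\<^sup>2 < L / 2"
    by (rule order_tendstoD(2)) (use \<open>0 < L\<close> in simp)
  obtain X where X: "\<And>x. X \<le> x \<Longrightarrow> L / 2 < (f' x)\<^sup>2" "\<And>x. X \<le> x \<Longrightarrow> (f (x + 1) - f x)\<^sup>2 < L / 2"
    using eventually_conj[OF ev1 ev2] unfolding eventually_at_top_linorder by blast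
  obtain z where z: "X < z" "f (X + 1) - f X = (X + 1 - X) * f' z"
    using MVT2[of X "X + 1" f f'] f by auto
  then show False
    using X(1)[of z] X(2)[of X] by simp
qed

locale novikov_wave =
  fixes c k :: real and \<phi> :: "real \<Rightarrow> real"
  assumes c_pos: "0 < c" and k_pos: "0 < k" and k_less: "k < sqrt c / 2"
    and wave: "solitary_wave c k \<phi>"
begin

abbreviation "a \<equiv> wave_a c k"
abbreviation "E \<equiv> wave_E c k"
abbreviation "\<phi>1 \<equiv> deriv \<phi>"
abbreviation "\<phi>2 \<equiv> deriv (deriv \<phi>)"
abbreviation "s x \<equiv> c - (\<phi> x)\<^sup>2"
abbreviation "\<mu> \<equiv> momentum \<phi>"

text \<open>Explicit first and second derivatives of \<open>a * s x powr (-3/2)\<close>, found by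
  differentiating with \<open>s' = - 2 * \<phi> * \<phi>1\<close>.\<close>

definition "\<mu>1 x = 3 * a * \<phi> x * \<phi>1 x * s x powr (-5/2)"
definition "\<mu>2 x = 3 * a * (s x powr (-5/2) * ((\<phi>1 x)\<^sup>2 + \<phi> x * \<phi>2 x)
  + 5 * s x powr (-7/2) * (\<phi> x)\<^sup>2 * (\<phi>1 x)\<^sup>2)"

section \<open>Parameters, rest state and derivatives of the wave\<close>

lemma four_k2_less: "4 * k\<^sup>2 < c"
proof -
  have "(2 * k)\<^sup>2 < (sqrt c)\<^sup>2"
    using k_pos k_less by (intro power_strict_mono) auto
  then show ?thesis using c_pos by (simp add: power_mult_distrib)
qed

lemma k2_less: "k\<^sup>2 < c"
  using four_k2_less k_pos by (smt (verit) zero_le_power2)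

lemma a_pos: "0 < a"
  using k_pos k2_less by (simp add: wave_a_def)

text \<open>The three consequences of the choice of \<open>a\<close>: the first makes
  \<open>k\<close> a rest state of the profile equation, the second serves its linearisation at
  \<open>k\<close>, and the third the constant of the energy integral.\<close>

lemma a_powr: "a * (c - k\<^sup>2) powr (-3/2) = k" "a * (c - k\<^sup>2) powr (-5/2) = k / (c - k\<^sup>2)"
  "a / sqrt (c - k\<^sup>2) = k * (c - k\<^sup>2)"
proof -
  let ?s = "c - k\<^sup>2"
  have "0 < ?s" using k2_less by simp
  have e1: "?s powr (3/2) * ?s powr (-3/2) = 1"
    using \<open>0 < ?s\<close> by (simp flip: powr_add)
  have e2: "?s powr (3/2) * ?s powr (-5/2) = 1 / ?s"
    unfolding powr_add[symmetric] using \<open>0 < ?s\<close> powr_minus_divide[of ?s 1] by simp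
  have e3: "?s powr (3/2) / sqrt ?s = ?s"
    using \<open>0 < ?s\<close> by (simp flip: powr_half_sqrt powr_diff)
  show "a * ?s powr (-3/2) = k" "a * ?s powr (-5/2) = k / ?s"
    unfolding wave_a_def mult.assoc e1 e2 by simp_all
  show "a / sqrt ?s = k * ?s"
    unfolding wave_a_def times_divide_eq_right[symmetric] e3 ..
qed

lemma s_pos: "0 < s x"
  using wave by (simp add: solitary_wave_def)

lemma \<phi>_even: "\<phi> (- x) = \<phi> x"
  using wave by (simp add: solitary_wave_def)

lemma \<phi>_lim: "(\<phi> \<longlongrightarrow> k) at_top"
  using wave by (simp add: solitary_wave_def)

lemma d\<phi>: "(\<phi> has_real_derivative \<phi>1 x) (at x)"
  using smooth_has_derivative[of \<phi> 0 x] wave by (simp add: solitary_wave_def)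

lemma d\<phi>1: "(\<phi>1 has_real_derivative \<phi>2 x) (at x)"
  using smooth_has_derivative[of \<phi> 1 x] wave by (simp add: solitary_wave_def)

lemma cont\<phi>: "continuous_on A \<phi>" and cont\<phi>1: "continuous_on A \<phi>1" and cont\<phi>2: "continuous_on A \<phi>2"
  using smooth_deriv_continuous[of \<phi> 0] smooth_deriv_continuous[of \<phi> 1]
    smooth_deriv_continuous[of \<phi> 2] wave
  by (auto simp: solitary_wave_def numeral_2_eq_2 intro: continuous_on_subset)

lemma \<mu>_eq: "\<mu> x = a * s x powr (-3/2)"
  using wave by (simp add: solitary_wave_def momentum_def)

lemma ode: "\<phi>2 x = \<phi> x - a * s x powr (-3/2)"
  using \<mu>_eq[of x] by (simp add: momentum_def)

lemma d\<mu>: "(\<mu> has_real_derivative \<mu>1 x) (at x)"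
proof -
  have p: "s x powr (-3/2 - 1) = s x powr (-5/2)"
    by (rule arg_cong) simp
  have "((\<lambda>x. a * s x powr (-3/2)) has_real_derivative \<mu>1 x) (at x)"
    using s_pos[of x] unfolding \<mu>1_def
    by (auto intro!: derivative_eq_intros d\<phi> simp: p)
  then show ?thesis
    by (simp add: \<mu>_eq[abs_def])
qed

lemma d\<mu>1: "(\<mu>1 has_real_derivative \<mu>2 x) (at x)"
proof -
  have p: "s x powr (-5/2 - 1) = s x powr (-7/2)"
    by (rule arg_cong) simp
  show ?thesis
    using s_pos[of x] unfolding \<mu>1_def[abs_def] \<mu>2_def
    by (auto intro!: derivative_eq_intros d\<phi> d\<phi>1 simp: p algebra_simps power2_eq_square)
qed

text \<open>The constant of the energy integral is found at infinity, where both \<open>\<phi> - k\<close> and \<open>\<phi>'\<close> vanish.\<close>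

lemma first_integral: "(\<phi>1 x)\<^sup>2 = 2 * E + (\<phi> x)\<^sup>2 - 2 * a * \<phi> x / (c * sqrt (s x))"
  and \<phi>1_lim: "(\<phi>1 \<longlongrightarrow> 0) at_top"
proof -
  define q where "q = a / c"
  \<comment> \<open>The profile equation is multiplied by \<open>\<phi>1\<close> and integrated. The
    derivative of \<open>t * (c - t\<^sup>2) powr (-1/2)\<close> is
    \<open>c * (c - t\<^sup>2) powr (-3/2)\<close>, whence the factor
    \<open>q = a / c\<close>.\<close>
  define W where "W x = (\<phi>1 x)\<^sup>2 / 2 - (\<phi> x)\<^sup>2 / 2 + q * (\<phi> x * s x powr (-1/2))" for x
  have "(W has_real_derivative 0) (at x)" for x
  proof -
    have p: "s x powr (-1/2 - 1) = s x powr (-3/2)" "s x powr (-1/2) = s x * s x powr (-3/2)"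
      using s_pos[of x] powr_mult_base[of "s x" "-3/2"] by simp_all
    have "(W has_real_derivative \<phi>1 x * \<phi>2 x - \<phi> x * \<phi>1 x
        + q * (\<phi>1 x * s x powr (-1/2) + \<phi> x * (\<phi> x * \<phi>1 x * s x powr (-3/2)))) (at x)"
      unfolding W_def using s_pos[of x]
      by (auto intro!: derivative_eq_intros d\<phi> d\<phi>1 simp: p(1) algebra_simps)
    moreover have "\<phi>1 x * \<phi>2 x - \<phi> x * \<phi>1 x
        + q * (\<phi>1 x * s x powr (-1/2) + \<phi> x * (\<phi> x * \<phi>1 x * s x powr (-3/2))) = 0"
      unfolding ode p(2) q_def using c_pos by (simp add: field_simps power2_eq_square)
    ultimately show ?thesis by simp
  qed
  then have W: "W x = W 0" for x
    using DERIV_isconst_all by blast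
  have sq: "(\<phi>1 x)\<^sup>2 = 2 * W 0 + (\<phi> x)\<^sup>2 - 2 * a * \<phi> x / (c * sqrt (s x))" for x
  proof -
    have "s x powr (-1/2) = 1 / sqrt (s x)"
      using powr_neg_half_int[OF s_pos[of x], of 1] by simp
    then have "(\<phi>1 x)\<^sup>2 = 2 * W x + (\<phi> x)\<^sup>2 - 2 * a * \<phi> x / (c * sqrt (s x))"
      unfolding W_def q_def by (simp add: algebra_simps)
    then show ?thesis by (simp only: W[of x])
  qed
  have "((\<lambda>x. 2 * W 0 + (\<phi> x)\<^sup>2 - 2 * a * \<phi> x / (c * sqrt (s x)))
      \<longlongrightarrow> 2 * W 0 + k\<^sup>2 - 2 * a * k / (c * sqrt (c - k\<^sup>2))) at_top"
    by (intro tendsto_intros \<phi>_lim) (use c_pos k2_less in auto)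
  then have sq_lim: "((\<lambda>x. (\<phi>1 x)\<^sup>2)
      \<longlongrightarrow> 2 * W 0 + k\<^sup>2 - 2 * a * k / (c * sqrt (c - k\<^sup>2))) at_top"
    by (simp add: sq)
  have L: "2 * W 0 + k\<^sup>2 - 2 * a * k / (c * sqrt (c - k\<^sup>2)) = 0"
    by (rule tendsto_imp_derivative_power2_limit_0[OF d\<phi> \<phi>_lim sq_lim])
  have "2 * a * k / (c * sqrt (c - k\<^sup>2)) = 2 * k / c * (a / sqrt (c - k\<^sup>2))"
    by simp
  also have "\<dots> = 2 * k / c * (k * (c - k\<^sup>2))"
    by (simp only: a_powr)
  finally have "2 * W 0 = 2 * k / c * (k * (c - k\<^sup>2)) - k\<^sup>2"
    using L by linarith
  then have "W 0 = E"
    using c_pos by (simp add: wave_E_def field_simps power2_eq_square)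
  with sq show "(\<phi>1 x)\<^sup>2 = 2 * E + (\<phi> x)\<^sup>2 - 2 * a * \<phi> x / (c * sqrt (s x))" by simp
  have "((\<lambda>x. sqrt ((\<phi>1 x)\<^sup>2)) \<longlongrightarrow> sqrt 0) at_top"
    using sq_lim unfolding L by (rule tendsto_real_sqrt)
  then show "(\<phi>1 \<longlongrightarrow> 0) at_top"
    by (simp add: tendsto_rabs_zero_iff)
qed

text \<open>The tails of \<open>\<phi>\<close> are close to \<open>k\<close>, and on the remaining
  compact interval the maximum of \<open>\<bar>\<phi>\<bar>\<close> is attained and lies below
  \<open>sqrt c\<close>. The resulting gap \<open>c - \<rho>\<^sup>2\<close> bounds the negative
  powers of \<open>s\<close> uniformly.\<close>

lemma range_bound:
  obtains \<rho> where "\<rho>\<^sup>2 < c" "\<And>x. \<phi> x \<in> {-\<rho>..\<rho>}" "k \<in> {-\<rho>..\<rho>}"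
proof -
  have "k < sqrt c"
    using k_less k_pos by simp
  then obtain \<rho>0 where \<rho>0: "k < \<rho>0" "\<rho>0 < sqrt c"
    using dense by blast
  have "((\<lambda>x. \<bar>\<phi> x\<bar>) \<longlongrightarrow> \<bar>k\<bar>) at_top"
    by (intro tendsto_intros \<phi>_lim)
  then have "\<forall>\<^sub>F x in at_top. \<bar>\<phi> x\<bar> < \<rho>0"
    by (rule order_tendstoD(2)) (use \<rho>0 k_pos in simp)
  then obtain X where X: "\<And>x. X \<le> x \<Longrightarrow> \<bar>\<phi> x\<bar> < \<rho>0"
    unfolding eventually_at_top_linorder by blast
  have "\<exists>y\<in>{-\<bar>X\<bar>..\<bar>X\<bar>}. \<forall>x\<in>{-\<bar>X\<bar>..\<bar>X\<bar>}. \<bar>\<phi> x\<bar> \<le> \<bar>\<phi> y\<bar>"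
    by (rule continuous_attains_sup) (auto intro!: continuous_intros cont\<phi>)
  then obtain y where y: "\<forall>x\<in>{-\<bar>X\<bar>..\<bar>X\<bar>}. \<bar>\<phi> x\<bar> \<le> \<bar>\<phi> y\<bar>"
    by blast
  define \<rho> where "\<rho> = max \<rho>0 \<bar>\<phi> y\<bar>"
  show thesis
  proof (rule that[of \<rho>])
    have "sqrt ((\<phi> y)\<^sup>2) < sqrt c"
      using s_pos[of y] by (intro real_sqrt_less_mono) simp
    then have "\<bar>\<rho>\<bar> < sqrt c"
      using \<rho>0 k_pos by (auto simp: \<rho>_def)
    then have "sqrt (\<rho>\<^sup>2) < sqrt c" by simp
    then show "\<rho>\<^sup>2 < c" by (simp only: real_sqrt_less_iff)
    \<comment> \<open>Evenness transfers the bound near plus infinity to minus infinity.\<close>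
    have abs_even: "\<phi> \<bar>x\<bar> = \<phi> x" for x
      using \<phi>_even[of x] by (cases "0 \<le> x") auto
    have "\<bar>\<phi> x\<bar> \<le> \<rho>" for x
    proof (cases "\<bar>x\<bar> \<le> \<bar>X\<bar>")
      case True
      then have "x \<in> {-\<bar>X\<bar>..\<bar>X\<bar>}" by auto
      then show ?thesis using y by (force simp: \<rho>_def)
    next
      case False
      then have "\<bar>\<phi> x\<bar> < \<rho>0"
        using X[of "\<bar>x\<bar>"] unfolding abs_even by linarith
      then show ?thesis by (simp add: \<rho>_def)
    qed
    then show "\<phi> x \<in> {-\<rho>..\<rho>}" for x
      by (simp add: abs_le_iff minus_le_iff)
    show "k \<in> {-\<rho>..\<rho>}"
      using \<rho>0 k_pos by (auto simp: \<rho>_def)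
  qed
qed

text \<open>Near \<open>k\<close> the equation reads \<open>(\<phi> - k)'' \<approx> \<lambda> (\<phi> - k)\<close> with
  \<open>\<lambda> = (c - 4 k\<^sup>2) / (c - k\<^sup>2) > 0\<close>, so that \<open>(\<phi> - k)\<^sup>2\<close> is a subsolution of a linear equation.\<close>

lemma integrable_\<phi>: "integrable lborel (\<lambda>x. \<phi> x - k)"
proof -
  \<comment> \<open>The profile equation reads \<open>\<phi>2 x = f (\<phi> x)\<close>, and
    \<open>l\<close> is the derivative of \<open>f\<close> at its zero \<open>k\<close>; near
    \<open>k\<close> the difference quotient therefore exceeds \<open>l / 2\<close>.\<close>
  define f where "f t = t - a * (c - t\<^sup>2) powr (-3/2)" for t
  define l where "l = (c - 4 * k\<^sup>2) / (c - k\<^sup>2)"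
  have "0 < l"
    using four_k2_less k2_less by (simp add: l_def)
  have "f k = 0"
    using a_powr(1) by (simp add: f_def)
  have "(f has_real_derivative 1 - 3 * k * (a * (c - k\<^sup>2) powr (-5/2))) (at k)"
    unfolding f_def using k2_less by (auto intro!: derivative_eq_intros)
  also have "1 - 3 * k * (a * (c - k\<^sup>2) powr (-5/2)) = l"
    unfolding a_powr l_def using k2_less by (simp add: field_simps power2_eq_square)
  finally have "((\<lambda>t. (f t - f k) / (t - k)) \<longlongrightarrow> l) (at k)"
    by (simp add: has_field_derivative_iff)
  then have "\<forall>\<^sub>F t in at k. l / 2 < (f t - f k) / (t - k)"
    by (rule order_tendstoD(1)) (use \<open>0 < l\<close> in simp)
  then obtain d where d: "0 < d" "\<And>t. t \<noteq> k \<Longrightarrow> \<bar>t - k\<bar> < d \<Longrightarrow> l / 2 < f t / (t - k)"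
    unfolding eventually_at using \<open>f k = 0\<close> by (auto simp: dist_real_def)
  have f_ge: "l / 2 * (t - k)\<^sup>2 \<le> (t - k) * f t" if "\<bar>t - k\<bar> < d" for t
  proof (cases "t = k")
    case False
    then have "l / 2 * (t - k)\<^sup>2 \<le> f t / (t - k) * (t - k)\<^sup>2"
      using d(2)[OF False that] by (intro mult_right_mono) auto
    also have "\<dots> = (t - k) * f t"
      using False by (simp add: power2_eq_square)
    finally show ?thesis .
  qed simp
  have "((\<lambda>x. \<bar>\<phi> x - k\<bar>) \<longlongrightarrow> \<bar>k - k\<bar>) at_top"
    by (intro tendsto_intros \<phi>_lim)
  then have "\<forall>\<^sub>F x in at_top. \<bar>\<phi> x - k\<bar> < d"
    by (rule order_tendstoD(2)) (use d in simp)
  then obtain X where X: "\<And>x. X \<le> x \<Longrightarrow> \<bar>\<phi> x - k\<bar> < d"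
    unfolding eventually_at_top_linorder by blast
  \<comment> \<open>The full \<open>l\<close> is reached although \<open>f_ge\<close> has only
    \<open>l / 2\<close>, since the second derivative of \<open>(\<phi> x - k)\<^sup>2\<close>
    contains \<open>(\<phi> x - k) * \<phi>2 x\<close> twice. Taking roots then gives
    \<open>\<phi> x - k\<close> the rate \<open>\<beta> / 2\<close>.\<close>
  define \<beta> where "\<beta> = sqrt l"
  have \<beta>: "0 < \<beta>" "\<beta>\<^sup>2 = l"
    using \<open>0 < l\<close> by (simp_all add: \<beta>_def)
  have decay: "(\<phi> x - k)\<^sup>2 \<le> (\<phi> X - k)\<^sup>2 * exp (- \<beta> * (x - X))" if "X \<le> x" for x
  proof (rule exponential_decay[OF \<beta>(1) _ _ _ _ _ that])
    show "((\<lambda>x. (\<phi> x - k)\<^sup>2) has_real_derivative 2 * (\<phi> x - k) * \<phi>1 x) (at x)" for x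
      by (auto intro!: derivative_eq_intros d\<phi>)
    show "((\<lambda>x. 2 * (\<phi> x - k) * \<phi>1 x) has_real_derivative
        2 * (\<phi>1 x)\<^sup>2 + 2 * ((\<phi> x - k) * \<phi>2 x)) (at x)" for x
      by (auto intro!: derivative_eq_intros d\<phi> d\<phi>1 simp: power2_eq_square)
    show "\<beta>\<^sup>2 * (\<phi> x - k)\<^sup>2 \<le> 2 * (\<phi>1 x)\<^sup>2 + 2 * ((\<phi> x - k) * \<phi>2 x)" if "X \<le> x" for x
    proof -
      have "\<phi>2 x = f (\<phi> x)"
        by (simp add: ode f_def)
      moreover have "l * (\<phi> x - k)\<^sup>2 \<le> 2 * ((\<phi> x - k) * f (\<phi> x))"
        using f_ge[OF X[OF that]] by linarith
      ultimately show ?thesis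
        unfolding \<beta>(2) by (intro add_increasing) simp_all
    qed
    have "((\<lambda>x. (\<phi> x - k)\<^sup>2) \<longlongrightarrow> (k - k)\<^sup>2) at_top"
      by (intro tendsto_intros \<phi>_lim)
    then show "((\<lambda>x. (\<phi> x - k)\<^sup>2) \<longlongrightarrow> 0) at_top" by simp
    have "((\<lambda>x. 2 * (\<phi> x - k) * \<phi>1 x) \<longlongrightarrow> 2 * (k - k) * 0) at_top"
      by (intro tendsto_intros \<phi>_lim \<phi>1_lim)
    then show "((\<lambda>x. 2 * (\<phi> x - k) * \<phi>1 x) \<longlongrightarrow> 0) at_top" by simp
  qed
  obtain \<rho> where \<rho>: "\<And>x. \<phi> x \<in> {-\<rho>..\<rho>}" "k \<in> {-\<rho>..\<rho>}"
    using range_bound by blast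
  have bdd: "\<bar>\<phi> x - k\<bar> \<le> 2 * \<rho>" for x
    using \<rho>(1)[of x] \<rho>(2) by auto
  have "0 \<le> \<rho>" using \<rho>(2) by simp
  have bound: "\<bar>\<phi> x - k\<bar> \<le> 2 * \<rho> * exp (- (\<beta> / 2) * (x - X))" for x
  proof (cases "X \<le> x")
    case True
    have "(\<phi> X - k)\<^sup>2 \<le> (2 * \<rho>)\<^sup>2"
      using power_mono[OF bdd[of X], of 2] by simp
    then have "(\<phi> x - k)\<^sup>2 \<le> (2 * \<rho>)\<^sup>2 * exp (- \<beta> * (x - X))"
      by (intro order_trans[OF decay[OF True]] mult_right_mono) auto
    also have "\<dots> = (2 * \<rho> * exp (- (\<beta> / 2) * (x - X)))\<^sup>2"
      using exp_double[of "- (\<beta> / 2) * (x - X)"] by (simp add: power_mult_distrib)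
    finally show ?thesis
      using \<open>0 \<le> \<rho>\<close> by (auto intro: power2_le_imp_le)
  next
    case False
    \<comment> \<open>Left of \<open>X\<close> the exponential is at least 1, so the global bound
      \<open>2 * \<rho>\<close> suffices.\<close>
    then have "2 * \<rho> * 1 \<le> 2 * \<rho> * exp (- (\<beta> / 2) * (x - X))"
      using \<open>0 \<le> \<rho>\<close> \<beta> by (intro mult_left_mono) (auto simp: mult_nonneg_nonpos)
    with bdd[of x] show ?thesis by simp
  qed
  have "\<phi> \<bar>x\<bar> = \<phi> x" for x
    using \<phi>_even[of x] by (cases "0 \<le> x") auto
  moreover have "exp (- (\<beta> / 2) * (\<bar>x\<bar> - X)) = exp (\<beta> / 2 * X) * exp (- (\<beta> / 2) * \<bar>x\<bar>)" for x
    by (subst exp_add[symmetric]) (simp add: right_diff_distrib)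
  ultimately have dom: "\<bar>\<phi> x - k\<bar> \<le> 2 * \<rho> * exp (\<beta> / 2 * X) * exp (- (\<beta> / 2) * \<bar>x\<bar>)" for x
    using bound[of "\<bar>x\<bar>"] by (simp only: mult.assoc)
  show ?thesis
  proof (rule Bochner_Integration.integrable_bound)
    show "integrable lborel (\<lambda>x. 2 * \<rho> * exp (\<beta> / 2 * X) * exp (- (\<beta> / 2) * \<bar>x\<bar>))"
      by (intro integrable_mult_right integrable_exp_minus_abs) (use \<beta> in simp)
    show "(\<lambda>x. \<phi> x - k) \<in> borel_measurable lborel"
      using cont\<phi> by (auto intro!: borel_measurable_continuous_onI continuous_intros)
    show "AE x in lborel. norm (\<phi> x - k) \<le> norm (2 * \<rho> * exp (\<beta> / 2 * X) * exp (- (\<beta> / 2) * \<bar>x\<bar>))"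
      unfolding real_norm_def by (intro AE_I2 order_trans[OF dom] abs_ge_self)
  qed
qed

text \<open>An instance of \<open>helmholtz_inv_eq\<close> for \<open>\<phi>\<close>:
  \<open>range_bound\<close> bounds \<open>\<phi>\<close>, the energy integral then bounds
  \<open>\<phi>1\<close>, and the profile equation gives
  \<open>\<phi>2 x \<le> \<phi> x\<close>.\<close>

lemma helmholtz_\<mu>: "helmholtz_inv \<mu> x = \<phi> x"
  and kernel_\<mu>: "integrable lborel (\<lambda>y. exp (- \<bar>x - y\<bar>) / 2 * \<mu> y)"
proof -
  obtain \<rho> where \<rho>: "\<rho>\<^sup>2 < c" "\<And>x. \<phi> x \<in> {-\<rho>..\<rho>}" "k \<in> {-\<rho>..\<rho>}"
    using range_bound by blast
  \<comment> \<open>One constant for both bounds: \<open>\<rho>\<close> covers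
    \<open>\<phi>\<close>, the first three terms cover the energy integral with
    \<open>(\<phi> x)\<^sup>2 < c\<close>, and the 1 is for
    \<open>\<bar>t\<bar> \<le> t\<^sup>2 + 1\<close> with \<open>t = \<phi>1 x\<close>.\<close>
  define B where "B = 2 * \<bar>E\<bar> + c + 2 * a * \<rho> / (c * sqrt (c - \<rho>\<^sup>2)) + \<rho> + 1"
  have "0 \<le> \<rho>" using \<rho>(3) by simp
  have "0 \<le> a * \<rho> / (c * sqrt (c - \<rho>\<^sup>2))"
    using a_pos c_pos \<open>0 \<le> \<rho>\<close> \<rho>(1) by simp
  have \<phi>_le: "\<bar>\<phi> x\<bar> \<le> \<rho>" for x
    using \<rho>(2)[of x] by (simp add: abs_le_iff minus_le_iff)
  have B0: "\<bar>\<phi> x\<bar> \<le> B" for x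
    using \<phi>_le[of x] c_pos \<open>0 \<le> a * \<rho> / (c * sqrt (c - \<rho>\<^sup>2))\<close> unfolding B_def by linarith
  have B1: "\<bar>\<phi>1 x\<bar> \<le> B" for x
  proof -
    have "(\<phi> x)\<^sup>2 \<le> \<rho>\<^sup>2"
      using power_mono[OF \<phi>_le[of x], of 2] by simp
    then have "a * \<bar>\<phi> x\<bar> / (c * sqrt (s x)) \<le> a * \<rho> / (c * sqrt (c - \<rho>\<^sup>2))"
      using a_pos c_pos \<rho>(1) \<phi>_le[of x] by (intro frac_le mult_left_mono mult_pos_pos) auto
    moreover have "- (a * \<phi> x / (c * sqrt (s x))) \<le> a * \<bar>\<phi> x\<bar> / (c * sqrt (s x))"
    proof -
      have "a * (- \<phi> x) / (c * sqrt (s x)) \<le> a * \<bar>\<phi> x\<bar> / (c * sqrt (s x))"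
        using a_pos c_pos s_pos[of x]
        by (intro divide_right_mono mult_left_mono) (auto intro: less_imp_le)
      then show ?thesis by simp
    qed
    ultimately have "(\<phi>1 x)\<^sup>2 + 1 \<le> B"
      using first_integral[of x] s_pos[of x] \<open>0 \<le> \<rho>\<close> unfolding B_def by (simp add: mult.assoc)
    moreover have "\<bar>\<phi>1 x\<bar> \<le> (\<phi>1 x)\<^sup>2 + 1"
      using zero_le_power2[of "\<bar>\<phi>1 x\<bar> - 1"] by (simp add: power2_diff)
    ultimately show ?thesis by simp
  qed
  have le: "\<phi>2 x \<le> \<phi> x" for x
    unfolding ode using a_pos by simp
  note H = helmholtz_inv_eq[OF d\<phi> d\<phi>1 cont\<phi>2 B0 B1 le, of x]
  show "helmholtz_inv \<mu> x = \<phi> x" "integrable lborel (\<lambda>y. exp (- \<bar>x - y\<bar>) / 2 * \<mu> y)"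
    using H unfolding momentum_def[abs_def] by simp_all
qed

section \<open>The Euler-Lagrange equation for the wave\<close>

lemma deriv_\<mu>: "deriv \<mu> = \<mu>1" "deriv \<mu>1 = \<mu>2"
  by (auto intro!: DERIV_imp_deriv d\<mu> d\<mu>1)

text \<open>With \<open>b = a powr (1/3)\<close> and \<open>r = sqrt (c - \<phi>\<^sup>2)\<close> all fractional powers become integral:
  \<open>\<mu> = (b / r)\<^sup>3\<close>.\<close>

lemma gradient_zero:
  "action_gradient (-9 * a powr (-2/3)) (9 * c * a powr (-4/3) * (2 * E + c)) \<mu> x = 0"
proof -
  define b where "b = a powr (1/3)"
  define r where "r = sqrt (s x)"
  define P where "P = (\<phi>1 x)\<^sup>2"
  \<comment> \<open>\<open>q\<close> is \<open>a / r\<close>, the combination that enters both the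
    profile equation and the energy integral.\<close>
  define q where "q = b ^ 3 / r"
  have [simp]: "0 < b" "0 < r" "b \<noteq> 0" "r \<noteq> 0"
    using a_pos s_pos[of x] by (simp_all add: b_def r_def less_imp_neq[symmetric])
  have a: "a = b ^ 3"
    using a_pos by (simp add: b_def powr_power)
  have r2: "r\<^sup>2 = c - (\<phi> x)\<^sup>2"
    using s_pos[of x] by (simp add: r_def)
  have s: "s x powr (-3/2) = 1 / r ^ 3" "s x powr (-5/2) = 1 / r ^ 5" "s x powr (-7/2) = 1 / r ^ 7"
    using powr_neg_half_int[OF s_pos[of x], of 3] powr_neg_half_int[OF s_pos[of x], of 5]
      powr_neg_half_int[OF s_pos[of x], of 7] by (simp_all add: r_def)
  have \<mu>: "\<mu> x = (b / r) ^ 3"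
    unfolding \<mu>_eq s a by (simp add: power_divide)
  have neg: "(t ^ 3) powr (- real n / 3) = 1 / t ^ n" if "0 < t" for t :: real and n
    using cube_powr_third[OF that, of "- real n"] that by (simp add: powr_minus_divide powr_realpow)
  have posi: "(t ^ 3) powr (real n / 3) = t ^ n" if "0 < t" for t :: real and n
    using cube_powr_third[OF that, of "real n"] that by (simp add: powr_realpow)
  have a_pow: "a powr (-2/3) = 1 / b ^ 2" "a powr (-4/3) = 1 / b ^ 4"
    unfolding a using neg[of b 2] neg[of b 4] by simp_all
  have \<mu>_pow: "\<mu> x powr (1/3) = b / r" "\<mu> x powr (-8/3) = (r / b) ^ 8" "\<mu> x powr (-5/3) = (r / b) ^ 5"
    "\<mu> x powr (11/3) = (b / r) ^ 11"
    unfolding \<mu> using posi[of "b / r" 1] neg[of "b / r" 8] neg[of "b / r" 5] posi[of "b / r" 11]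
    by (simp_all add: power_divide)
  have ode': "\<phi>2 x = \<phi> x - q / r\<^sup>2"
    unfolding ode s a by (simp add: q_def power2_eq_square power3_eq_cube)
  have fi: "P = 2 * E + (\<phi> x)\<^sup>2 - 2 * \<phi> x * q / c"
    unfolding P_def first_integral by (simp add: q_def a r_def[symmetric] mult.commute mult.left_commute)
  have m1: "(\<mu>1 x)\<^sup>2 = 9 * b ^ 6 * (\<phi> x)\<^sup>2 * P / r ^ 10"
    unfolding \<mu>1_def s a P_def by (simp add: power_mult_distrib power_divide flip: power_mult)
  have m2: "\<mu>2 x = 3 * b ^ 3 * ((P + \<phi> x * \<phi>2 x) / r ^ 5 + 5 * (\<phi> x)\<^sup>2 * P / r ^ 7)"
    unfolding \<mu>2_def s a P_def by simp
  \<comment> \<open>Each of the five terms carries the common factor \<open>6 * r / b ^ 5\<close>;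
    what remains is a polynomial in \<open>r\<close>, \<open>q\<close>, \<open>P\<close>,
    \<open>\<phi>\<close> and \<open>\<phi>2\<close>.\<close>
  have "action_gradient (-9 * a powr (-2/3)) (9 * c * a powr (-4/3) * (2 * E + c)) \<mu> x
      = 6 * r / b ^ 5 * (c * (2 * E + c) - 3 * \<phi> x * q
          - r\<^sup>2 * (P + \<phi> x * \<phi>2 x) - 5 * (\<phi> x)\<^sup>2 * P - r ^ 4 + 4 * (\<phi> x)\<^sup>2 * P)"
  proof -
    have t0: "2 * (-9 * (1 / b ^ 2)) * \<phi> x = 6 * r / b ^ 5 * (- 3 * \<phi> x * q)"
      by (simp add: q_def field_simps eval_nat_numeral)
    have t1: "2 * (9 * c * (1 / b ^ 4) * (2 * E + c)) / (3 * (b / r)) = 6 * r / b ^ 5 * (c * (2 * E + c))"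
      by (simp add: field_simps eval_nat_numeral)
    have t2: "2 * (r / b) ^ 8 * \<mu>2 x
        = 6 * r / b ^ 5 * (r\<^sup>2 * (P + \<phi> x * \<phi>2 x) + 5 * (\<phi> x)\<^sup>2 * P)"
      unfolding m2 by (simp add: field_simps eval_nat_numeral)
    have t3: "6 * (r / b) ^ 5 = 6 * r / b ^ 5 * r ^ 4"
      by (simp add: field_simps eval_nat_numeral)
    have t4: "8 * (\<mu>1 x)\<^sup>2 / (3 * (b / r) ^ 11) = 6 * r / b ^ 5 * (4 * (\<phi> x)\<^sup>2 * P)"
      unfolding m1 by (simp add: field_simps eval_nat_numeral)
    show ?thesis
      unfolding action_gradient_def helmholtz_\<mu> deriv_\<mu> a_pow \<mu>_pow t0 t1 t2 t3 t4
      by (simp only: ring_distribs)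
  qed
  also have "c * (2 * E + c) - 3 * \<phi> x * q - r\<^sup>2 * (P + \<phi> x * \<phi>2 x) - 5 * (\<phi> x)\<^sup>2 * P
      - r ^ 4 + 4 * (\<phi> x)\<^sup>2 * P = 0"
  proof -
    have cP: "c * P = c * (2 * E + (\<phi> x)\<^sup>2) - 2 * \<phi> x * q"
      unfolding fi using c_pos by (simp add: field_simps)
    have r2\<phi>2: "r\<^sup>2 * \<phi>2 x = r\<^sup>2 * \<phi> x - q"
      unfolding ode' by (simp add: field_simps)
    \<comment> \<open>The terms in \<open>P\<close> add up to
      \<open>- (r\<^sup>2 + (\<phi> x)\<^sup>2) * P = - c * P\<close>, so the energy integral times
      \<open>c\<close> and the profile equation times \<open>r\<^sup>2\<close> can be inserted free
      of denominators.\<close>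
    have "c * (2 * E + c) - 3 * \<phi> x * q - r\<^sup>2 * (P + \<phi> x * \<phi>2 x) - 5 * (\<phi> x)\<^sup>2 * P
        - r ^ 4 + 4 * (\<phi> x)\<^sup>2 * P
        = c * (2 * E + c) - 3 * \<phi> x * q - (r\<^sup>2 + (\<phi> x)\<^sup>2) * P - \<phi> x * (r\<^sup>2 * \<phi>2 x) - (r\<^sup>2)\<^sup>2"
      by (simp add: algebra_simps)
    also have "\<dots> = c * (2 * E + c) - 3 * \<phi> x * q - c * P - \<phi> x * (r\<^sup>2 * \<phi> x - q) - (r\<^sup>2)\<^sup>2"
      unfolding r2\<phi>2 by (simp add: r2)
    also have "\<dots> = 0"
      unfolding cP r2 by (simp add: algebra_simps power2_eq_square)
    finally show ?thesis .
  qed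
  finally show ?thesis by simp
qed

text \<open>Verifies the hypotheses of \<open>critical_point_actionI\<close>; the integrability
  statements at \<open>\<mu>\<close> all go back to \<open>integrable_\<phi>\<close> and the uniform
  range bounds.\<close>

lemma momentum_critical_point:
  "critical_point (action_domain k)
     (action k (-9 * a powr (-2/3)) (9 * c * a powr (-4/3) * (2 * E + c))) \<mu>"
proof -
  obtain \<rho> where \<rho>: "\<rho>\<^sup>2 < c" "\<And>x. \<phi> x \<in> {-\<rho>..\<rho>}" "k \<in> {-\<rho>..\<rho>}"
    using range_bound by blast
  have pos: "0 < c - t\<^sup>2" if "t \<in> {-\<rho>..\<rho>}" for t
  proof -
    have "\<bar>t\<bar> \<le> \<rho>" using that by auto
    then have "t\<^sup>2 \<le> \<rho>\<^sup>2" using power_mono[of "\<bar>t\<bar>" \<rho> 2] by simp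
    then show ?thesis using \<rho>(1) by simp
  qed
  have pos0: "0 < c - \<rho>\<^sup>2" using \<rho>(1) by simp
  have s_ge: "c - \<rho>\<^sup>2 \<le> s x" for x
  proof -
    have "\<bar>\<phi> x\<bar> \<le> \<rho>" using \<rho>(2)[of x] by auto
    then show ?thesis using power_mono[of "\<bar>\<phi> x\<bar>" \<rho> 2] by simp
  qed
  \<comment> \<open>\<open>\<alpha>\<close> and \<open>\<beta>\<close> are the values of
    \<open>a * s powr (-3/2)\<close> at the extremes \<open>s = c\<close> and
    \<open>s = c - \<rho>\<^sup>2\<close>.\<close>
  define \<alpha> where "\<alpha> = a * c powr (-3/2)"
  define \<beta> where "\<beta> = a * (c - \<rho>\<^sup>2) powr (-3/2)"
  have "0 < \<alpha>"
    using a_pos c_pos by (simp add: \<alpha>_def)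
  have \<mu>_range: "\<mu> x \<in> {\<alpha>..\<beta>}" for x
    unfolding \<alpha>_def \<beta>_def \<mu>_eq
    using a_pos pos0 s_ge[of x] s_pos[of x] by (auto intro!: mult_left_mono powr_mono2')
  have k_range: "k \<in> {\<alpha>..\<beta>}"
  proof -
    have "\<bar>k\<bar> \<le> \<rho>" using \<rho>(3) by auto
    then have "c - \<rho>\<^sup>2 \<le> c - k\<^sup>2" using power_mono[of "\<bar>k\<bar>" \<rho> 2] by simp
    then have "a * (c - k\<^sup>2) powr (-3/2) \<in> {\<alpha>..\<beta>}"
      unfolding \<alpha>_def \<beta>_def
      using a_pos pos0 k2_less by (auto intro!: mult_left_mono powr_mono2')
    then show ?thesis by (simp only: a_powr)
  qed
  have cont\<mu>: "continuous_on UNIV \<mu>" and cont\<mu>1: "continuous_on UNIV \<mu>1"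
    by (intro continuous_at_imp_continuous_on ballI DERIV_isCont[OF d\<mu>] DERIV_isCont[OF d\<mu>1])+
  have [measurable]: "\<phi> \<in> borel_measurable borel" "\<mu> \<in> borel_measurable borel"
    by (intro borel_measurable_continuous_onI cont\<phi> cont\<mu>)+
  have "integrable lborel (\<lambda>x. a * s x powr (-3/2) - a * (c - k\<^sup>2) powr (-3/2))"
  proof (rule integrable_comp_minus_const[OF _ _ cont\<phi> \<rho>(2,3) integrable_\<phi>])
    fix t assume "t \<in> {-\<rho>..\<rho>}"
    show "((\<lambda>t. a * (c - t\<^sup>2) powr (-3/2)) has_real_derivative
        a * (-3/2 * (c - t\<^sup>2) powr (-3/2 - 1) * (- (2 * t)))) (at t)"
      using pos[OF \<open>t \<in> _\<close>] by (auto intro!: derivative_eq_intros)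
  next
    show "continuous_on {-\<rho>..\<rho>} (\<lambda>t. a * (-3/2 * (c - t\<^sup>2) powr (-3/2 - 1) * (- (2 * t))))"
      using pos by (intro continuous_intros) (auto simp: less_imp_neq[symmetric])
  qed
  then have int\<mu>: "integrable lborel (\<lambda>x. \<mu> x - k)"
    by (simp only: a_powr \<mu>_eq)
  have int\<phi>1: "integrable lborel (\<lambda>x. (\<phi>1 x)\<^sup>2)"
  proof -
    \<comment> \<open>The energy integral expresses the square of \<open>\<phi>1\<close> as
      \<open>?G (\<phi> x)\<close>, and the value of \<open>E\<close> makes
      \<open>?G k = 0\<close>.\<close>
    let ?G = "\<lambda>t. 2 * E + t\<^sup>2 - 2 * a / c * (t * (c - t\<^sup>2) powr (-1/2))"
    let ?G' = "\<lambda>t. 2 * t - 2 * a / c * ((c - t\<^sup>2) powr (-1/2)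
        + t * (-1/2 * (c - t\<^sup>2) powr (-1/2 - 1) * (- (2 * t))))"
    have half: "t powr (-1/2) = 1 / sqrt t" if "0 < t" for t
      using powr_neg_half_int[OF that, of 1] by simp
    have "integrable lborel (\<lambda>x. ?G (\<phi> x) - ?G k)"
    proof (rule integrable_comp_minus_const[OF _ _ cont\<phi> \<rho>(2,3) integrable_\<phi>])
      fix t assume "t \<in> {-\<rho>..\<rho>}"
      define d where "d = 2 * a / c"
      show "(?G has_real_derivative ?G' t) (at t)"
        unfolding d_def[symmetric]
        using pos[OF \<open>t \<in> _\<close>] by (auto intro!: derivative_eq_intros simp: algebra_simps)
    next
      show "continuous_on {-\<rho>..\<rho>} ?G'"
        using pos by (intro continuous_intros) (auto simp: less_imp_neq[symmetric])
    qed
    moreover have "?G k = 0"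
    proof -
      have "2 * a / c * (k * (c - k\<^sup>2) powr (-1/2)) = 2 / c * (k * (a / sqrt (c - k\<^sup>2)))"
        using half[of "c - k\<^sup>2"] k2_less by simp
      also have "\<dots> = 2 / c * (k * (k * (c - k\<^sup>2)))"
        unfolding a_powr ..
      finally have G2: "2 * a / c * (k * (c - k\<^sup>2) powr (-1/2)) = 2 / c * (k * (k * (c - k\<^sup>2)))" .
      show ?thesis
        unfolding G2 using c_pos by (simp add: wave_E_def field_simps power2_eq_square)
    qed
    moreover have "?G (\<phi> x) = (\<phi>1 x)\<^sup>2" for x
      unfolding first_integral half[OF s_pos] by simp
    ultimately show ?thesis by (simp only: diff_zero)
  qed
  have int\<mu>1: "integrable lborel (\<lambda>x. (\<mu>1 x)\<^sup>2)"
  proof -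
    have "integrable lborel (\<lambda>x. (3 * a * \<phi> x * s x powr (-5/2))\<^sup>2 * (\<phi>1 x)\<^sup>2)"
    proof (rule integrable_bounded_mult[OF int\<phi>1])
      fix x
      have "\<bar>3 * a * \<phi> x * s x powr (-5/2)\<bar> \<le> 3 * a * \<rho> * (c - \<rho>\<^sup>2) powr (-5/2)"
        unfolding abs_mult
        using a_pos pos0 s_ge[of x] \<rho>(2)[of x] by (auto intro!: mult_mono powr_mono2')
      then show "\<bar>(3 * a * \<phi> x * s x powr (-5/2))\<^sup>2\<bar> \<le> (3 * a * \<rho> * (c - \<rho>\<^sup>2) powr (-5/2))\<^sup>2"
        using power_mono[of "\<bar>3 * a * \<phi> x * s x powr (-5/2)\<bar>" _ 2] by simp
    qed measurable
    then show ?thesis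
      by (simp add: \<mu>1_def power_mult_distrib mult_ac)
  qed
  have powr_int: "integrable lborel (\<lambda>x. \<mu> x powr p - k powr p)" for p
  proof (rule integrable_comp_minus_const[OF _ _ cont\<mu> \<mu>_range k_range int\<mu>])
    show "((\<lambda>t. t powr p) has_real_derivative p * t powr (p - 1)) (at t)" if "t \<in> {\<alpha>..\<beta>}" for t
      using that \<open>0 < \<alpha>\<close> by (intro has_real_derivative_powr) auto
    show "continuous_on {\<alpha>..\<beta>} (\<lambda>t. p * t powr (p - 1))"
      using \<open>0 < \<alpha>\<close> by (intro continuous_intros) auto
  qed
  have \<mu>_abs: "\<bar>\<mu> x - k\<bar> \<le> \<beta>" for x
    using \<mu>_range[of x] k_range \<open>0 < \<alpha>\<close> by auto
  show ?thesis
  proof (rule critical_point_actionI[OF d\<mu> d\<mu>1 \<open>0 < \<alpha>\<close> _ kernel_\<mu>])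
    show "\<alpha> \<le> \<mu> x" for x
      using \<mu>_range[of x] by simp
    show "continuous_on UNIV (helmholtz_inv \<mu>)"
      using cont\<phi> by (simp add: helmholtz_\<mu>[abs_def])
    show "integrable lborel (\<lambda>x. (\<mu> x - k)\<^sup>2)"
      unfolding power2_eq_square by (rule integrable_bounded_mult[OF int\<mu> _ \<mu>_abs]) measurable
    \<comment> \<open>The energy density \<open>\<mu> x * \<phi> x - k\<^sup>2\<close> is split into
      two terms, one for each of the deviations \<open>\<mu> x - k\<close> and
      \<open>\<phi> x - k\<close>.\<close>
    have "integrable lborel (\<lambda>x. \<phi> x * (\<mu> x - k))"
      using \<rho>(2) by (intro integrable_bounded_mult[OF int\<mu>, where B = \<rho>]) (auto simp: abs_le_iff minus_le_iff)
    then have "integrable lborel (\<lambda>x. \<phi> x * (\<mu> x - k) + k * (\<phi> x - k))"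
      by (intro Bochner_Integration.integrable_add integrable_mult_right integrable_\<phi>)
    moreover have "energy_density k \<mu> = (\<lambda>x. \<phi> x * (\<mu> x - k) + k * (\<phi> x - k))"
      by (simp add: fun_eq_iff energy_density_def helmholtz_\<mu> algebra_simps power2_eq_square)
    ultimately show "integrable lborel (energy_density k \<mu>)" by simp
    show "integrable lborel (F1_density k \<mu>)"
      using powr_int by (simp add: F1_density_def[abs_def])
    have "integrable lborel (\<lambda>x. \<mu> x powr (-8/3) * (\<mu>1 x)\<^sup>2)"
    proof (rule integrable_bounded_mult[OF int\<mu>1])
      show "\<bar>\<mu> x powr (-8/3)\<bar> \<le> \<alpha> powr (-8/3)" for x
        using \<mu>_range[of x] \<open>0 < \<alpha>\<close> by (auto intro!: powr_mono2')
    qed measurable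
    then show "integrable lborel (F2_density k \<mu>)"
      unfolding F2_density_def deriv_\<mu>
      by (intro Bochner_Integration.integrable_add integrable_mult_right powr_int)
  qed (rule int\<mu>1 gradient_zero)+
qed

end

theorem proposition2p7:
  fixes c k a E \<omega>0 \<omega>1 :: real and \<phi> \<mu> :: "real \<Rightarrow> real"
  assumes "c > 0" and "0 < k" and "k < sqrt c / 2"
    and "a = wave_a c k" and "E = wave_E c k"
    and "solitary_wave c k \<phi>" and "\<mu> = momentum \<phi>"
    and "\<omega>0 = -9 * a powr (-2/3)"
    and "\<omega>1 = 9 * c * a powr (-4/3) * (2 * E + c)"
  shows "critical_point (action_domain k) (action k \<omega>0 \<omega>1) \<mu> \<and>
         (\<forall>x. action_gradient \<omega>0 \<omega>1 \<mu> x = 0)"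
proof -
  interpret novikov_wave c k \<phi>
    by unfold_locales (rule assms)+
  show ?thesis
    unfolding assms(4,5,7-9) using momentum_critical_point gradient_zero by blast
qed

end
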